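(* For each $\varepsilon>0$ there exists a metric tree $\Gamma$ with $\operatorname{diam}\Gamma=1$ such that $\mu_2(\Gamma)$ is simple and $$\max\{\mathrm{dist}(x,y): x,y\in M\}<\varepsilon .$$
   Context: A metric graph $\Gamma$ is given by a finite connected discrete graph with vertex set $\mathcal V$ and edge set $\mathcal E$ (loops and parallel edges allowed), where each edge $e$ is assigned a length $L(e)\in(0,\infty)$ and identified with the interval $[0,L(e)]$, the endpoints $0$ and $L(e)$ corresponding to the originating vertex $o(e)$ and terminal vertex $t(e)$ of $e$; with the natural path metric $\mathrm{dist}$, $\Gamma$ is a compact metric space, and $\operatorname{diam}\Gamma=\max\{\mathrm{dist}(x,y):x,y\in\Gamma\}$. A metric tree is a metric graph without cycles. The standard Laplacian $-\Delta_\Gamma$ in $L^2(\Gamma)=\bigoplus_{e}L^2(0,L(e))$ acts as $f\mapsto -f_e''$ on every edge ($f_e:=f|_e$), on the domain of functions $f$ with $f_e\in H^2(0,L(e))$ for all $e$, continuous on $\Gamma$, and satisfying the Kirchhoff condition $\sum_{t(e)=v} f_e'(L(e)) - \sum_{o(e)=v} f_e'(0)=0$ at each vertex $v$. Its eigenvalues, counted with multiplicities, are $0=\mu_1(\Gamma)<\mu_2(\Gamma)\le\mu_3(\Gamma)\le\dots$. Eigenfunctions are always taken real-valued. $M$ is the set of all $x\in\Gamma$ for which there exists an eigenfunction $\psi$ corresponding to $\mu_2(\Gamma)$ with $\psi(x)=\max_{y\in\Gamma}\psi(y)$ (since $-\psi$ is also an eigenfunction, points of global minimum are included). *)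

theory Defs
  imports
    "HOL-Analysis.Analysis"
    "HOL-Library.Function_Algebras"
    "Graph_Theory.Digraph_Component"
begin

section \<open>Metric graphs\<close>

text \<open>
  The orientation of an edge \<open>e\<close> only fixes its parametrisation: \<open>tail G e\<close> is the originating
  vertex (parameter \<open>0\<close>) and \<open>head G e\<close> the terminal vertex (parameter \<open>L e\<close>).
  The library's connectedness is that of the underlying undirected graph.
\<close>

locale metric_graph = fin_digraph G for G :: "('v, 'e) pre_digraph" +
  fixes L :: "'e \<Rightarrow> real"
  assumes connected: "Digraph_Component.connected G"
    and length_pos: "e \<in> arcs G \<Longrightarrow> 0 < L e"

text \<open>
  Each edge \<open>e\<close> becomes two opposite arcs \<open>(e, True)\<close> and \<open>(e, False)\<close>. A cycle of the undirected
  multigraph \<open>G\<close> is then a directed cycle of the doubled graph using every edge at most once;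
  loops and pairs of parallel edges are cycles.
\<close>

definition doubled :: "('v, 'e) pre_digraph \<Rightarrow> ('v, 'e \<times> bool) pre_digraph" where
  "doubled G =
    \<lparr> verts = verts G,
      arcs = arcs G \<times> UNIV,
      tail = (\<lambda>(e, b). if b then tail G e else head G e),
      head = (\<lambda>(e, b). if b then head G e else tail G e) \<rparr>"

definition undirected_cycle :: "('v, 'e) pre_digraph \<Rightarrow> ('e \<times> bool) list \<Rightarrow> bool" where
  "undirected_cycle G p \<longleftrightarrow> pre_digraph.cycle (doubled G) p \<and> distinct (map fst p)"

locale metric_tree = metric_graph +
  assumes acyclic: "\<nexists>p. undirected_cycle G p"

text \<open>
  The points of the quotient of the disjoint union of the intervals \<open>[0, L e]\<close>: vertices and
  interior points of edges. The map \<open>on_edge G L e\<close> is the quotient map restricted to \<open>[0, L e]\<close>.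
\<close>

datatype ('v, 'e) point = Vertex 'v | Interior 'e real

definition points :: "('v, 'e) pre_digraph \<Rightarrow> ('e \<Rightarrow> real) \<Rightarrow> ('v, 'e) point set" where
  "points G L = Vertex ` verts G \<union> {Interior e s | e s. e \<in> arcs G \<and> 0 < s \<and> s < L e}"

definition on_edge :: "('v, 'e) pre_digraph \<Rightarrow> ('e \<Rightarrow> real) \<Rightarrow> 'e \<Rightarrow> real \<Rightarrow> ('v, 'e) point" where
  "on_edge G L e s =
    (if s = 0 then Vertex (tail G e) else if s = L e then Vertex (head G e) else Interior e s)"

text \<open>
  \<open>path_length G L x r y\<close>: some path from \<open>x\<close> to \<open>y\<close>, composed of finitely many segments of edges,
  has length \<open>r\<close>.
\<close>

inductive path_length ::
  "('v, 'e) pre_digraph \<Rightarrow> ('e \<Rightarrow> real) \<Rightarrow> ('v, 'e) point \<Rightarrow> real \<Rightarrow> ('v, 'e) point \<Rightarrow> bool"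
  for G L where
    refl: "x \<in> points G L \<Longrightarrow> path_length G L x 0 x"
  | step: "path_length G L x r (on_edge G L e s) \<Longrightarrow> e \<in> arcs G \<Longrightarrow>
      s \<in> {0..L e} \<Longrightarrow> t \<in> {0..L e} \<Longrightarrow> path_length G L x (r + \<bar>t - s\<bar>) (on_edge G L e t)"

definition graph_dist ::
  "('v, 'e) pre_digraph \<Rightarrow> ('e \<Rightarrow> real) \<Rightarrow> ('v, 'e) point \<Rightarrow> ('v, 'e) point \<Rightarrow> real" where
  "graph_dist G L x y = Inf {r. path_length G L x r y}"

definition distances ::
  "('v, 'e) pre_digraph \<Rightarrow> ('e \<Rightarrow> real) \<Rightarrow> ('v, 'e) point set \<Rightarrow> real set" where
  "distances G L S = {graph_dist G L x y | x y. x \<in> S \<and> y \<in> S}"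

text \<open>
  A relation instead of \<open>Max\<close> or \<open>Sup\<close>, whose values say nothing about infinite respectively
  empty or unbounded sets: here the maximum is asserted to be attained.
\<close>

definition has_max :: "real set \<Rightarrow> real \<Rightarrow> bool" where
  "has_max S m \<longleftrightarrow> m \<in> S \<and> (\<forall>a\<in>S. a \<le> m)"

definition graph_continuous ::
  "('v, 'e) pre_digraph \<Rightarrow> ('e \<Rightarrow> real) \<Rightarrow> (('v, 'e) point \<Rightarrow> real) \<Rightarrow> bool" where
  "graph_continuous G L f \<longleftrightarrow>
    (\<forall>x\<in>points G L. \<forall>r>0. \<exists>d>0. \<forall>y\<in>points G L. graph_dist G L x y < d \<longrightarrow> \<bar>f y - f x\<bar> < r)"

section \<open>The standard Laplacian\<close>

text \<open>
  In one dimension \<open>H\<^sup>1(0, l)\<close> consists of the absolutely continuous functions on \<open>[0, l]\<close> with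
  derivative in \<open>L\<^sup>2(0, l)\<close>, that is, of the indefinite integrals of \<open>L\<^sup>2\<close> functions. The derivative
  \<open>g\<close> is determined up to null sets; \<open>f\<close> is the continuous representative.
\<close>

definition L2_on :: "real \<Rightarrow> (real \<Rightarrow> real) \<Rightarrow> bool" where
  "L2_on l g \<longleftrightarrow> set_borel_measurable lebesgue {0..l} g \<and> set_integrable lebesgue {0..l} (\<lambda>s. (g s)\<^sup>2)"

definition H1_deriv :: "real \<Rightarrow> (real \<Rightarrow> real) \<Rightarrow> (real \<Rightarrow> real) \<Rightarrow> bool" where
  "H1_deriv l f g \<longleftrightarrow> L2_on l g \<and> (\<forall>x\<in>{0..l}. f x = f 0 + (LINT s:{0..x}|lebesgue. g s))"

definition H2_deriv2 :: "real \<Rightarrow> (real \<Rightarrow> real) \<Rightarrow> (real \<Rightarrow> real) \<Rightarrow> bool" where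
  "H2_deriv2 l f h \<longleftrightarrow> (\<exists>g. H1_deriv l f g \<and> H1_deriv l g h)"

definition H2_on :: "real \<Rightarrow> (real \<Rightarrow> real) \<Rightarrow> bool" where
  "H2_on l f \<longleftrightarrow> (\<exists>h. H2_deriv2 l f h)"

definition edge_fun ::
  "('v, 'e) pre_digraph \<Rightarrow> ('e \<Rightarrow> real) \<Rightarrow> (('v, 'e) point \<Rightarrow> real) \<Rightarrow> 'e \<Rightarrow> real \<Rightarrow> real" where
  "edge_fun G L f e = (\<lambda>s. f (on_edge G L e s))"

text \<open>One-sided at the end points \<open>0\<close> and \<open>L e\<close>.\<close>

definition edge_deriv ::
  "('v, 'e) pre_digraph \<Rightarrow> ('e \<Rightarrow> real) \<Rightarrow> (('v, 'e) point \<Rightarrow> real) \<Rightarrow> 'e \<Rightarrow> real \<Rightarrow> real" where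
  "edge_deriv G L f e s = vector_derivative (edge_fun G L f e) (at s within {0..L e})"

definition kirchhoff ::
  "('v, 'e) pre_digraph \<Rightarrow> ('e \<Rightarrow> real) \<Rightarrow> (('v, 'e) point \<Rightarrow> real) \<Rightarrow> bool" where
  "kirchhoff G L f \<longleftrightarrow>
    (\<forall>v\<in>verts G. (\<Sum>e | e \<in> arcs G \<and> head G e = v. edge_deriv G L f e (L e))
      - (\<Sum>e | e \<in> arcs G \<and> tail G e = v. edge_deriv G L f e 0) = 0)"

text \<open>
  Functions on the graph are represented by functions that vanish off \<open>points G L\<close>, so that
  the representation is unique and linear.
\<close>

definition laplacian_domain ::
  "('v, 'e) pre_digraph \<Rightarrow> ('e \<Rightarrow> real) \<Rightarrow> (('v, 'e) point \<Rightarrow> real) set" where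
  "laplacian_domain G L =
    {f. (\<forall>x. x \<notin> points G L \<longrightarrow> f x = 0) \<and>
        (\<forall>e\<in>arcs G. H2_on (L e) (edge_fun G L f e)) \<and>
        graph_continuous G L f \<and> kirchhoff G L f}"

text \<open>
  The graph of the operator: the component on the edge \<open>e\<close> of the image of \<open>f\<close> in the direct sum of the
  \<open>L\<^sup>2(0, L e)\<close> is represented by \<open>u e\<close>.
\<close>

definition standard_laplacian ::
  "('v, 'e) pre_digraph \<Rightarrow> ('e \<Rightarrow> real) \<Rightarrow> (('v, 'e) point \<Rightarrow> real) \<Rightarrow> ('e \<Rightarrow> real \<Rightarrow> real) \<Rightarrow> bool"
  where
  "standard_laplacian G L f u \<longleftrightarrow> f \<in> laplacian_domain G L \<and>
    (\<forall>e\<in>arcs G. H2_deriv2 (L e) (edge_fun G L f e) (\<lambda>s. - u e s))"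

section \<open>Eigenvalues and eigenfunctions\<close>

definition eigenspace ::
  "('v, 'e) pre_digraph \<Rightarrow> ('e \<Rightarrow> real) \<Rightarrow> real \<Rightarrow> (('v, 'e) point \<Rightarrow> real) set" where
  "eigenspace G L lam = {f. standard_laplacian G L f (\<lambda>e s. lam * edge_fun G L f e s)}"

definition eigenfunction ::
  "('v, 'e) pre_digraph \<Rightarrow> ('e \<Rightarrow> real) \<Rightarrow> real \<Rightarrow> (('v, 'e) point \<Rightarrow> real) \<Rightarrow> bool" where
  "eigenfunction G L lam f \<longleftrightarrow> f \<in> eigenspace G L lam \<and> f \<noteq> 0"

definition eigenvalues :: "('v, 'e) pre_digraph \<Rightarrow> ('e \<Rightarrow> real) \<Rightarrow> real set" where
  "eigenvalues G L = {lam. \<exists>f. eigenfunction G L lam f}"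

definition fun_scale :: "real \<Rightarrow> ('a \<Rightarrow> real) \<Rightarrow> 'a \<Rightarrow> real" where
  "fun_scale c f = (\<lambda>x. c * f x)"

lemma vector_space_fun_scale: "vector_space fun_scale"
  by unfold_locales (auto simp: fun_scale_def fun_eq_iff algebra_simps)

definition eigen_multiplicity :: "('v, 'e) pre_digraph \<Rightarrow> ('e \<Rightarrow> real) \<Rightarrow> real \<Rightarrow> nat" where
  "eigen_multiplicity G L lam = vector_space.dim fun_scale (eigenspace G L lam)"

text \<open>The \<open>k\<close>-th eigenvalue, \<open>k \<ge> 1\<close>, counted with multiplicities.\<close>

definition mu :: "('v, 'e) pre_digraph \<Rightarrow> ('e \<Rightarrow> real) \<Rightarrow> nat \<Rightarrow> real" where
  "mu G L k = (LEAST lam. lam \<in> eigenvalues G L \<and>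
    k \<le> (\<Sum>\<nu> | \<nu> \<in> eigenvalues G L \<and> \<nu> \<le> lam. eigen_multiplicity G L \<nu>))"

definition hot_spots :: "('v, 'e) pre_digraph \<Rightarrow> ('e \<Rightarrow> real) \<Rightarrow> ('v, 'e) point set" where
  "hot_spots G L = {x \<in> points G L.
    \<exists>\<psi>. eigenfunction G L (mu G L 2) \<psi> \<and> (\<forall>y\<in>points G L. \<psi> y \<le> \<psi> x)}"

end

theory Submission
  imports Defs
begin

text \<open>
  Two stars, each with \<open>n\<^sup>2\<close> edges of length \<open>1/n\<close>, are joined to a root by single edges of length
  \<open>1/n\<close>, and an edge of length \<open>1 - 2/n\<close> is attached to the root. The edges next to the root are
  bottlenecks between two large masses, so the slowest mode lives on the stars: it is
  odd under exchanging the stars and vanishes on the long edge. Explicitly, its frequency \<open>k\<close> solves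
  \<open>tan (k/n) = 1/n\<close>, hence \<open>k < 1\<close>. For a smaller positive frequency, continuity at the root gives
  all branches amplitudes of the same sign, and then their fluxes into the root cannot cancel.
  The mode attains its extrema exactly at the leaves of the stars,
  and these are at distance at most \<open>4/n\<close> from each other.
\<close>

section \<open>Sobolev functions on an interval\<close>

lemma L2_on_continuous:
  assumes "continuous_on {0..l} g"
  shows "L2_on l g"
proof -
  have "set_integrable lebesgue {0..l} g"
    using assms by (rule absolutely_integrable_continuous_real)
  then have "set_borel_measurable lebesgue {0..l} g"
    unfolding set_integrable_def set_borel_measurable_def by (rule borel_measurable_integrable)
  moreover have "set_integrable lebesgue {0..l} (\<lambda>s. (g s)\<^sup>2)"
    using assms by (intro absolutely_integrable_continuous_real continuous_intros)
  ultimately show ?thesis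
    by (simp add: L2_on_def)
qed

text \<open>On a bounded interval the function 1 + g^2 is integrable, and it dominates |g|.\<close>

lemma L2_on_imp_set_integrable:
  assumes "L2_on l g"
  shows "set_integrable lebesgue {0..l} g"
proof (rule set_integrable_bound)
  show "set_integrable lebesgue {0..l} (\<lambda>s. 1 + (g s)\<^sup>2)"
    using assms
    by (intro set_integral_add(1)) (auto simp: L2_on_def intro: absolutely_integrable_continuous_real)
  show "set_borel_measurable lebesgue {0..l} g"
    using assms by (simp add: L2_on_def)
  have "\<bar>x\<bar> \<le> 1 + x\<^sup>2" for x :: real
  proof -
    have "0 \<le> (\<bar>x\<bar> - 1)\<^sup>2 + \<bar>x\<bar>" by simp
    then show ?thesis by (simp add: power2_eq_square algebra_simps)
  qed
  then show "AE x in lebesgue. x \<in> {0..l} \<longrightarrow> norm (g x) \<le> norm (1 + (g x)\<^sup>2)"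
    by (simp add: abs_of_nonneg)
qed

text \<open>The fundamental theorem of calculus turns classical derivatives into weak ones; this is
  how explicit functions are shown to lie in the domain.\<close>

lemma H1_derivI:
  assumes "\<And>s. s \<in> {0..l} \<Longrightarrow> (f has_vector_derivative g s) (at s within {0..l})"
    and g: "continuous_on {0..l} g"
  shows "H1_deriv l f g"
  unfolding H1_deriv_def
proof (intro conjI ballI)
  show "L2_on l g"
    using g by (rule L2_on_continuous)
  fix x assume x: "x \<in> {0..l}"
  have "(g has_integral (f x - f 0)) {0..x}"
    using x by (intro fundamental_theorem_of_calculus)
      (auto intro: has_vector_derivative_within_subset[OF assms(1)])
  moreover have "set_integrable lebesgue {0..x} g"
    using x by (intro absolutely_integrable_continuous_real continuous_on_subset[OF g]) auto
  ultimately show "f x = f 0 + (LINT s:{0..x}|lebesgue. g s)"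
    by (simp add: set_lebesgue_integral_eq_integral integral_unique)
qed

lemma H1_deriv_eq_integral:
  assumes "H1_deriv l f g" "x \<in> {0..l}"
  shows "f x = f 0 + integral {0..x} g"
proof -
  have "set_integrable lebesgue {0..x} g"
    using L2_on_imp_set_integrable[of l g] assms
    by (auto simp: H1_deriv_def intro: set_integrable_subset)
  moreover have "f x = f 0 + (LINT s:{0..x}|lebesgue. g s)"
    using assms unfolding H1_deriv_def by blast
  ultimately show ?thesis
    by (simp only: set_lebesgue_integral_eq_integral)
qed

lemma H1_deriv_continuous_on:
  assumes "H1_deriv l f g"
  shows "continuous_on {0..l} f"
proof -
  have "g integrable_on {0..l}"
    using assms L2_on_imp_set_integrable set_lebesgue_integral_eq_integral(1)
    by (auto simp: H1_deriv_def)
  then have "continuous_on {0..l} (\<lambda>x. f 0 + integral {0..x} g)"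
    by (intro continuous_intros indefinite_integral_continuous_1)
  then show ?thesis
    using H1_deriv_eq_integral[OF assms] continuous_on_cong by (metis (no_types, lifting))
qed

text \<open>If the weak derivative is continuous, the indefinite integral is differentiable at every
  point and not only almost everywhere. This is the step from weak to classical solutions.\<close>

lemma H1_deriv_has_vector_derivative:
  assumes "H1_deriv l f g" "continuous_on {0..l} g" "x \<in> {0..l}"
  shows "(f has_vector_derivative g x) (at x within {0..l})"
proof -
  have "((\<lambda>x. f 0 + integral {0..x} g) has_vector_derivative 0 + g x) (at x within {0..l})"
    using assms by (intro derivative_intros integral_has_vector_derivative)
  then show ?thesis
    using has_vector_derivative_transform[OF assms(3) H1_deriv_eq_integral[OF assms(1)]] by simp
qed

section \<open>The equation \<open>f'' = -\<lambda> f\<close>\<close>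

text \<open>Together with \<open>sn\<close> this is the fundamental system of f'' = -lam f with
  initial data (1, 0) and (0, 1), real for every sign of \<open>lam\<close>. At
  \<open>lam = 0\<close> the hyperbolic branch already gives the constant 1.\<close>

definition cs :: "real \<Rightarrow> real \<Rightarrow> real" where
  "cs lam s = (if lam > 0 then cos (sqrt lam * s) else cosh (sqrt (- lam) * s))"

definition sn :: "real \<Rightarrow> real \<Rightarrow> real" where
  "sn lam s = (if lam > 0 then sin (sqrt lam * s) / sqrt lam
    else if lam = 0 then s else sinh (sqrt (- lam) * s) / sqrt (- lam))"

lemma cs_0 [simp]: "cs lam 0 = 1"
  by (simp add: cs_def)

lemma sn_0 [simp]: "sn lam 0 = 0"
  by (simp add: sn_def)

lemma cs_has_derivative [derivative_intros]:
  "(cs lam has_real_derivative - lam * sn lam s) (at s within X)"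
proof (cases lam "0 :: real" rule: linorder_cases)
  case less
  define k where "k = sqrt (- lam)"
  have "k > 0" "lam = - (k * k)"
    using less by (auto simp: k_def)
  then show ?thesis
    using less unfolding cs_def sn_def k_def[symmetric]
    by (auto intro!: derivative_eq_intros simp: field_simps)
next
  case greater
  define k where "k = sqrt lam"
  have "k > 0" "lam = k * k"
    using greater by (auto simp: k_def)
  then show ?thesis
    using greater unfolding cs_def sn_def k_def[symmetric]
    by (auto intro!: derivative_eq_intros simp: field_simps)
qed (simp add: cs_def sn_def[abs_def] cs_def[abs_def])

lemma sn_has_derivative [derivative_intros]:
  "(sn lam has_real_derivative cs lam s) (at s within X)"
proof (cases lam "0 :: real" rule: linorder_cases)
  case less
  define k where "k = sqrt (- lam)"
  have "k > 0"
    using less by (simp add: k_def)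
  then show ?thesis
    using less unfolding cs_def sn_def k_def[symmetric] by (auto intro!: derivative_eq_intros)
next
  case greater
  define k where "k = sqrt lam"
  have "k > 0"
    using greater by (simp add: k_def)
  then show ?thesis
    using greater unfolding cs_def sn_def k_def[symmetric] by (auto intro!: derivative_eq_intros)
qed (simp add: cs_def sn_def[abs_def])

lemma constant_of_zero_derivative_Icc:
  fixes u :: "real \<Rightarrow> real"
  assumes "\<And>x. x \<in> {0..l} \<Longrightarrow> (u has_real_derivative 0) (at x within {0..l})" "s \<in> {0..l}"
  shows "u s = u 0"
proof -
  have "\<exists>c. \<forall>x\<in>{0..l}. u x = c"
    using assms(1) by (intro has_field_derivative_zero_constant) auto
  then show ?thesis
    using assms(2) by force
qed

text \<open>The left-hand side is the Wronskian of \<open>cs\<close> and \<open>sn\<close>, hence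
  conserved. This treats all signs of \<open>lam\<close> at once.\<close>

lemma cs_sn_pythagoras:
  assumes "s \<ge> 0"
  shows "(cs lam s)\<^sup>2 + lam * (sn lam s)\<^sup>2 = 1"
proof -
  have "(cs lam s)\<^sup>2 + lam * (sn lam s)\<^sup>2 = (cs lam 0)\<^sup>2 + lam * (sn lam 0)\<^sup>2"
    using assms by (intro constant_of_zero_derivative_Icc[of s]) (auto intro!: derivative_eq_intros)
  then show ?thesis
    by simp
qed

text \<open>The two combinations of \<open>f\<close> and \<open>g = f'\<close> with zero derivative are the coefficients of \<open>f\<close> with
  respect to \<open>cs\<close> and \<open>sn\<close>.\<close>

lemma second_order_ode_solution:
  assumes f: "\<And>x. x \<in> {0..l} \<Longrightarrow> (f has_real_derivative g x) (at x within {0..l})"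
    and g: "\<And>x. x \<in> {0..l} \<Longrightarrow> (g has_real_derivative - lam * f x) (at x within {0..l})"
    and s: "s \<in> {0..l}"
  shows "f s = f 0 * cs lam s + g 0 * sn lam s"
    and "g s = - lam * f 0 * sn lam s + g 0 * cs lam s"
proof -
  define c d where "c = cs lam s" and "d = sn lam s"
  have u: "f s * c - g s * d = f 0"
  proof -
    have "((\<lambda>s. f s * cs lam s - g s * sn lam s) has_real_derivative
        (f x * (- lam * sn lam x) + g x * cs lam x) - (g x * cs lam x + (- lam * f x) * sn lam x))
        (at x within {0..l})" if "x \<in> {0..l}" for x
      by (intro DERIV_diff DERIV_mult' f g cs_has_derivative sn_has_derivative that)
    then have "f s * cs lam s - g s * sn lam s = f 0 * cs lam 0 - g 0 * sn lam 0"
      by (intro constant_of_zero_derivative_Icc[OF _ s]) simp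
    then show ?thesis
      by (simp add: c_def d_def)
  qed
  have w: "lam * (f s * d) + g s * c = g 0"
  proof -
    have "((\<lambda>s. lam * (f s * sn lam s) + g s * cs lam s) has_real_derivative
        lam * (f x * cs lam x + g x * sn lam x) + (g x * (- lam * sn lam x) + (- lam * f x) * cs lam x))
        (at x within {0..l})" if "x \<in> {0..l}" for x
      by (intro DERIV_add DERIV_cmult DERIV_mult' f g cs_has_derivative sn_has_derivative that)
    then have "lam * (f s * sn lam s) + g s * cs lam s = lam * (f 0 * sn lam 0) + g 0 * cs lam 0"
      by (intro constant_of_zero_derivative_Icc[OF _ s]) (simp add: algebra_simps)
    then show ?thesis
      by (simp add: c_def d_def)
  qed
  have p: "c\<^sup>2 + lam * d\<^sup>2 = 1"
    using cs_sn_pythagoras[of s lam] s by (simp add: c_def d_def)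
  \<comment> \<open>Inserting \<open>u\<close> and \<open>w\<close> for the initial data cancels the
    mixed terms; the remaining factor is the Wronskian.\<close>
  have "f 0 * c + g 0 * d = f s * (c\<^sup>2 + lam * d\<^sup>2)"
    by (simp flip: u w add: algebra_simps power2_eq_square)
  then show "f s = f 0 * cs lam s + g 0 * sn lam s"
    unfolding p by (simp add: c_def d_def)
  have "- lam * f 0 * d + g 0 * c = g s * (c\<^sup>2 + lam * d\<^sup>2)"
    by (simp flip: u w add: algebra_simps power2_eq_square)
  then show "g s = - lam * f 0 * sn lam s + g 0 * cs lam s"
    unfolding p by (simp add: c_def d_def)
qed

lemma cs_nonpos_ge_1: "lam \<le> 0 \<Longrightarrow> cs lam s \<ge> 1"
  by (simp add: cs_def cosh_real_ge_1)

lemma sn_nonpos_pos: "lam \<le> 0 \<Longrightarrow> s > 0 \<Longrightarrow> sn lam s > 0"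
  by (simp add: sn_def)

section \<open>Distances\<close>

lemma path_length_nonneg: "path_length G L x r y \<Longrightarrow> 0 \<le> r"
  by (induction rule: path_length.induct) auto

lemma graph_dist_le: "path_length G L x r y \<Longrightarrow> graph_dist G L x y \<le> r"
  unfolding graph_dist_def
  by (rule cInf_lower) (auto intro!: bdd_belowI[of _ 0] dest: path_length_nonneg)

text \<open>The edgewise bounds add up over the segments of the path.\<close>

lemma lipschitz_path_length:
  assumes "path_length G L x r y"
    and "\<And>e s t. e \<in> arcs G \<Longrightarrow> s \<in> {0..L e} \<Longrightarrow> t \<in> {0..L e} \<Longrightarrow>
      \<bar>F (on_edge G L e t) - F (on_edge G L e s)\<bar> \<le> K * \<bar>t - s\<bar>"
  shows "\<bar>F y - F x\<bar> \<le> K * r"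
  using assms(1)
proof (induction rule: path_length.induct)
  case (step x r e s t)
  then show ?case
    using assms(2)[of e s t] by (auto simp: distrib_left)
qed simp

text \<open>The bound along each path passes to the infimum; the given path ensures that this
  infimum is not over the empty set. Both lower bounds on distances and continuity on the graph come
  from here.\<close>

lemma lipschitz_graph_dist:
  assumes "path_length G L x r y" "K > 0"
    and "\<And>e s t. e \<in> arcs G \<Longrightarrow> s \<in> {0..L e} \<Longrightarrow> t \<in> {0..L e} \<Longrightarrow>
      \<bar>F (on_edge G L e t) - F (on_edge G L e s)\<bar> \<le> K * \<bar>t - s\<bar>"
  shows "\<bar>F y - F x\<bar> \<le> K * graph_dist G L x y"
proof -
  have "\<bar>F y - F x\<bar> / K \<le> r" if "path_length G L x r y" for r
    using lipschitz_path_length[where F = F and K = K, OF that assms(3)] \<open>K > 0\<close>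
    by (simp add: field_simps)
  then have "\<bar>F y - F x\<bar> / K \<le> graph_dist G L x y"
    unfolding graph_dist_def using assms(1) by (intro cInf_greatest) auto
  then show ?thesis
    using \<open>K > 0\<close> by (simp add: field_simps)
qed

context metric_graph
begin

lemma on_edge_in_points: "e \<in> arcs G \<Longrightarrow> s \<in> {0..L e} \<Longrightarrow> on_edge G L e s \<in> points G L"
  by (auto simp: on_edge_def points_def)

lemma on_edge_tail [simp]: "on_edge G L e 0 = Vertex (tail G e)"
  by (simp add: on_edge_def)

lemma on_edge_head: "e \<in> arcs G \<Longrightarrow> on_edge G L e (L e) = Vertex (head G e)"
  using length_pos[of e] by (simp add: on_edge_def)

lemma path_length_on_edge:
  assumes "e \<in> arcs G" "s \<in> {0..L e}" "t \<in> {0..L e}"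
  shows "path_length G L (on_edge G L e s) \<bar>t - s\<bar> (on_edge G L e t)"
  using path_length.step[OF path_length.refl[OF on_edge_in_points[OF assms(1,2)]] assms] by simp

lemma path_length_trans:
  assumes "path_length G L y q z" "path_length G L x r y"
  shows "path_length G L x (r + q) z"
  using assms
proof (induction rule: path_length.induct)
  case (step x q e s t)
  then show ?case
    using path_length.step[of G L _ "r + q" e s t] by (simp add: add.assoc)
qed simp

lemma path_length_sym:
  assumes "path_length G L x r y"
  shows "path_length G L y r x"
  using assms
proof (induction rule: path_length.induct)
  case (step x r e s t)
  then show ?case
    using path_length_trans[OF step.IH path_length_on_edge[of e t s]]
    by (simp add: abs_minus_commute add.commute)
qed (rule path_length.refl)

end

section \<open>Existence of paths, and continuity from edgewise Lipschitz bounds\<close>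

context metric_graph
begin

text \<open>Induction along a chain in the symmetric closure of the arcs: an edge can be traversed
  in either direction.\<close>

lemma ex_path_length_Vertex:
  assumes "u \<in> verts G" "v \<in> verts G"
  shows "\<exists>r. path_length G L (Vertex u) r (Vertex v)"
proof -
  have "(u, v) \<in> rtrancl_on (verts G) ((arcs_ends G)\<^sup>s)"
    using assms connected by (simp add: connected_conv)
  then show ?thesis
  proof (induction rule: rtrancl_on_induct)
    case base
    then show ?case
      using path_length.refl[of "Vertex u" G L] by (auto simp: points_def)
  next
    case (step v w)
    then obtain r where r: "path_length G L (Vertex u) r (Vertex v)"
      by blast
    obtain e where e: "e \<in> arcs G" "(tail G e, head G e) = (v, w) \<or> (tail G e, head G e) = (w, v)"
      using step.hyps by (auto simp: symcl_def arcs_ends_def arc_to_ends_def)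
    have "path_length G L (Vertex (tail G e)) (L e) (Vertex (head G e))"
      using path_length_on_edge[of e 0 "L e"] on_edge_head[of e] e(1) length_pos[of e] by simp
    then have "path_length G L (Vertex v) (L e) (Vertex w)"
      using e(2) path_length_sym by auto
    then show ?case
      using path_length_trans r by blast
  qed
qed

lemma ex_path_length:
  assumes "x \<in> points G L" "y \<in> points G L"
  shows "\<exists>r. path_length G L x r y"
proof -
  have *: "\<exists>v\<in>verts G. \<exists>r. path_length G L x r (Vertex v)" if "x \<in> points G L" for x
  proof (cases x)
    case (Vertex v)
    then show ?thesis
      using that path_length.refl[OF that] by (auto simp: points_def)
  next
    case (Interior e s)
    then have e: "e \<in> arcs G" "0 < s" "s < L e"
      using that by (auto simp: points_def)
    then have "path_length G L x \<bar>0 - s\<bar> (Vertex (tail G e))"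
      using path_length_on_edge[of e s 0] Interior by (simp add: on_edge_def)
    then show ?thesis
      using e by (auto intro!: bexI[of _ "tail G e"])
  qed
  obtain u r v q where "u \<in> verts G" "path_length G L x r (Vertex u)"
    "v \<in> verts G" "path_length G L y q (Vertex v)"
    using *[OF assms(1)] *[OF assms(2)] by blast
  then show ?thesis
    using ex_path_length_Vertex[of u v] by (meson path_length_trans path_length_sym)
qed

lemma graph_continuous_lipschitz:
  assumes "K > 0"
    and "\<And>e s t. e \<in> arcs G \<Longrightarrow> s \<in> {0..L e} \<Longrightarrow> t \<in> {0..L e} \<Longrightarrow>
      \<bar>f (on_edge G L e t) - f (on_edge G L e s)\<bar> \<le> K * \<bar>t - s\<bar>"
  shows "graph_continuous G L f"
  unfolding graph_continuous_def
proof (intro ballI allI impI)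
  fix x and r :: real assume x: "x \<in> points G L" and "r > 0"
  have "\<bar>f y - f x\<bar> < r" if "y \<in> points G L" "graph_dist G L x y < r / K" for y
  proof -
    have "\<bar>f y - f x\<bar> \<le> K * graph_dist G L x y"
      using ex_path_length[OF x that(1)] lipschitz_graph_dist[OF _ assms] by blast
    also have "\<dots> < r"
      using that(2) \<open>K > 0\<close> by (simp add: field_simps)
    finally show ?thesis .
  qed
  then show "\<exists>d>0. \<forall>y\<in>points G L. graph_dist G L x y < d \<longrightarrow> \<bar>f y - f x\<bar> < r"
    using \<open>r > 0\<close> \<open>K > 0\<close> by (intro exI[of _ "r / K"]) auto
qed

section \<open>Eigenfunctions on the edges\<close>

lemma edge_deriv_eqI:
  assumes "e \<in> arcs G" "s \<in> {0..L e}"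
    and "(edge_fun G L f e has_vector_derivative d) (at s within {0..L e})"
  shows "edge_deriv G L f e s = d"
  unfolding edge_deriv_def
  using assms length_pos[OF assms(1)] by (intro vector_derivative_within_closed_interval)

text \<open>Regularity bootstrap: the function and its weak derivative are both H^1, hence
  continuous, so the equation holds classically. The initial data at the tail then determine the
  function on the edge.\<close>

lemma eigenspace_on_edge:
  assumes f: "f \<in> eigenspace G L lam" and e: "e \<in> arcs G" and s: "s \<in> {0..L e}"
  shows "f (on_edge G L e s) =
      f (Vertex (tail G e)) * cs lam s + edge_deriv G L f e 0 * sn lam s"
    and "edge_deriv G L f e s =
      - lam * f (Vertex (tail G e)) * sn lam s + edge_deriv G L f e 0 * cs lam s"
proof -
  define h where "h = edge_fun G L f e"
  obtain g where g: "H1_deriv (L e) h g" "H1_deriv (L e) g (\<lambda>s. - (lam * h s))"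
    using f e by (auto simp: eigenspace_def standard_laplacian_def H2_deriv2_def h_def)
  have h': "(h has_vector_derivative g x) (at x within {0..L e})" if "x \<in> {0..L e}" for x
    using H1_deriv_has_vector_derivative[OF g(1) H1_deriv_continuous_on[OF g(2)] that] .
  have g': "(g has_vector_derivative - (lam * h x)) (at x within {0..L e})" if "x \<in> {0..L e}" for x
    using that H1_deriv_continuous_on[OF g(1)]
    by (intro H1_deriv_has_vector_derivative[OF g(2)]) (auto intro!: continuous_intros)
  have d: "edge_deriv G L f e x = g x" if "x \<in> {0..L e}" for x
    using edge_deriv_eqI[OF e that] h'[OF that] by (simp add: h_def)
  have "0 \<in> {0..L e}"
    using length_pos[OF e] by simp
  then have d0: "edge_deriv G L f e 0 = g 0"
    by (rule d)
  have h0: "h 0 = f (Vertex (tail G e))"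
    by (simp add: h_def edge_fun_def)
  have "(h has_real_derivative g x) (at x within {0..L e})"
    "(g has_real_derivative - lam * h x) (at x within {0..L e})" if "x \<in> {0..L e}" for x
    using h'[OF that] g'[OF that] by (simp_all add: has_real_derivative_iff_has_vector_derivative)
  note sol = second_order_ode_solution[OF this s]
  show "f (on_edge G L e s) =
      f (Vertex (tail G e)) * cs lam s + edge_deriv G L f e 0 * sn lam s"
    using sol(1) by (simp add: d0 h0) (simp add: h_def edge_fun_def)
  show "edge_deriv G L f e s =
      - lam * f (Vertex (tail G e)) * sn lam s + edge_deriv G L f e 0 * cs lam s"
    using sol(2) by (simp add: d0 d[OF s] h0)
qed

lemma eigenspace_eqI:
  assumes "f \<in> eigenspace G L lam" "g \<in> eigenspace G L lam"
    and "\<And>v. v \<in> verts G \<Longrightarrow> f (Vertex v) = g (Vertex v)"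
    and "\<And>e. e \<in> arcs G \<Longrightarrow> edge_deriv G L f e 0 = edge_deriv G L g e 0"
  shows "f = g"
proof
  fix x
  show "f x = g x"
  proof (cases "x \<in> points G L")
    case False
    then show ?thesis
      using assms(1,2) by (auto simp: eigenspace_def standard_laplacian_def laplacian_domain_def)
  next
    case True
    show ?thesis
    proof (cases x)
      case (Vertex v)
      then show ?thesis
        using True assms(3) by (auto simp: points_def)
    next
      case (Interior e s)
      then have e: "e \<in> arcs G" "s \<in> {0..L e}" "x = on_edge G L e s"
        using True by (auto simp: points_def on_edge_def)
      then show ?thesis
        using eigenspace_on_edge(1)[OF assms(1) e(1,2)] eigenspace_on_edge(1)[OF assms(2) e(1,2)]
          assms(3,4) by simp
    qed
  qed
qed

text \<open>Criterion for explicit candidates, given by profiles that are smooth on the whole line.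
  The common bound \<open>K\<close> on the slopes makes the glued function Lipschitz along edges and
  hence continuous on the graph.\<close>

lemma eigenspaceI:
  assumes supp: "\<And>x. x \<notin> points G L \<Longrightarrow> f x = 0"
    and f: "\<And>e s. e \<in> arcs G \<Longrightarrow> s \<in> {0..L e} \<Longrightarrow> f (on_edge G L e s) = \<phi> e s"
    and \<phi>: "\<And>e s. e \<in> arcs G \<Longrightarrow> (\<phi> e has_real_derivative \<phi>' e s) (at s)"
    and \<phi>': "\<And>e s. e \<in> arcs G \<Longrightarrow> (\<phi>' e has_real_derivative - lam * \<phi> e s) (at s)"
    and bound: "\<And>e s. e \<in> arcs G \<Longrightarrow> \<bar>\<phi>' e s\<bar> \<le> K"
    and kirchhoff: "\<And>v. v \<in> verts G \<Longrightarrow> (\<Sum>e | e \<in> arcs G \<and> head G e = v. \<phi>' e (L e))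
      = (\<Sum>e | e \<in> arcs G \<and> tail G e = v. \<phi>' e 0)"
  shows "f \<in> eigenspace G L lam"
proof -
  have deriv: "(edge_fun G L f e has_vector_derivative \<phi>' e s) (at s within {0..L e})"
    if "e \<in> arcs G" "s \<in> {0..L e}" for e s
  proof (rule has_vector_derivative_transform)
    show "(\<phi> e has_vector_derivative \<phi>' e s) (at s within {0..L e})"
      using \<phi>[OF that(1), THEN has_field_derivative_at_within]
      by (simp add: has_real_derivative_iff_has_vector_derivative)
  qed (use that f in \<open>auto simp: edge_fun_def\<close>)
  have H2: "H2_deriv2 (L e) (edge_fun G L f e) (\<lambda>s. - (lam * edge_fun G L f e s))"
    if e: "e \<in> arcs G" for e
    unfolding H2_deriv2_def
  proof (intro exI conjI)
    have "continuous_on {0..L e} (\<phi>' e)"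
      using \<phi>'[OF e] by (meson DERIV_isCont continuous_at_imp_continuous_on)
    then show "H1_deriv (L e) (edge_fun G L f e) (\<phi>' e)"
      using deriv[OF e] by (intro H1_derivI)
    have "continuous_on {0..L e} (edge_fun G L f e)"
      using deriv[OF e] by (rule continuous_on_vector_derivative)
    then show "H1_deriv (L e) (\<phi>' e) (\<lambda>s. - (lam * edge_fun G L f e s))"
    proof (intro H1_derivI continuous_intros)
      fix s assume s: "s \<in> {0..L e}"
      then show "(\<phi>' e has_vector_derivative - (lam * edge_fun G L f e s)) (at s within {0..L e})"
        using \<phi>'[OF e, THEN has_field_derivative_at_within] f[OF e s]
        by (simp add: has_real_derivative_iff_has_vector_derivative edge_fun_def)
    qed
  qed
  have "graph_continuous G L f"
  proof (rule graph_continuous_lipschitz)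
    show "\<bar>K\<bar> + 1 > 0" by simp
    fix e s t assume *: "e \<in> arcs G" "s \<in> {0..L e}" "t \<in> {0..L e}"
    have "norm (\<phi> e t - \<phi> e s) \<le> (\<bar>K\<bar> + 1) * norm (t - s)"
    proof (rule field_differentiable_bound[of UNIV "\<phi> e" "\<phi>' e"])
      show "norm (\<phi>' e z) \<le> \<bar>K\<bar> + 1" for z
        using bound[OF *(1), of z] by simp
    qed (use \<phi>[OF *(1)] in auto)
    then show "\<bar>f (on_edge G L e t) - f (on_edge G L e s)\<bar> \<le> (\<bar>K\<bar> + 1) * \<bar>t - s\<bar>"
      using f * by simp
  qed
  moreover have "edge_deriv G L f e 0 = \<phi>' e 0" "edge_deriv G L f e (L e) = \<phi>' e (L e)"
    if "e \<in> arcs G" for e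
    using that deriv length_pos[OF that] by (auto intro!: edge_deriv_eqI)
  then have "(\<Sum>e | e \<in> arcs G \<and> head G e = v. edge_deriv G L f e (L e))
      = (\<Sum>e | e \<in> arcs G \<and> head G e = v. \<phi>' e (L e))"
    "(\<Sum>e | e \<in> arcs G \<and> tail G e = v. edge_deriv G L f e 0)
      = (\<Sum>e | e \<in> arcs G \<and> tail G e = v. \<phi>' e 0)" for v
    by (auto intro: sum.cong)
  then have "kirchhoff G L f"
    using kirchhoff by (simp add: kirchhoff_def)
  ultimately show ?thesis
    using supp H2
    by (auto simp: eigenspace_def standard_laplacian_def laplacian_domain_def H2_on_def)
qed

end

text \<open>Vertex values are prescribed separately, so that no incident edge has to be chosen.
  Agreement of the profiles with them is checked edge by edge.\<close>

definition glue ::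
  "('v, 'e) pre_digraph \<Rightarrow> ('e \<Rightarrow> real) \<Rightarrow> ('v \<Rightarrow> real) \<Rightarrow> ('e \<Rightarrow> real \<Rightarrow> real) \<Rightarrow> ('v, 'e) point \<Rightarrow> real"
  where
  "glue G L w \<phi> x =
    (if x \<in> points G L then case x of Vertex v \<Rightarrow> w v | Interior e s \<Rightarrow> \<phi> e s else 0)"

lemma (in metric_graph) glue_on_edge:
  assumes "e \<in> arcs G" "s \<in> {0..L e}"
    and "\<phi> e 0 = w (tail G e)" "\<phi> e (L e) = w (head G e)"
  shows "glue G L w \<phi> (on_edge G L e s) = \<phi> e s"
  using assms on_edge_in_points[OF assms(1,2)] by (auto simp: glue_def on_edge_def)

section \<open>Multiplicities\<close>

lemma eigen_multiplicity_eq_1: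
  assumes "\<psi> \<noteq> 0" and "eigenspace G L lam = range (\<lambda>t. fun_scale t \<psi>)"
  shows "eigen_multiplicity G L lam = 1"
proof -
  interpret vector_space "fun_scale :: real \<Rightarrow> (('a, 'b) point \<Rightarrow> real) \<Rightarrow> _"
    by (rule vector_space_fun_scale)
  show ?thesis
    unfolding eigen_multiplicity_def assms(2)
  proof (rule dim_unique[of "{\<psi>}"])
    show "{\<psi>} \<subseteq> range (\<lambda>t. fun_scale t \<psi>)"
      by (auto intro!: image_eqI[of _ _ 1])
    show "range (\<lambda>t. fun_scale t \<psi>) \<subseteq> span {\<psi>}"
      by (auto intro: span_scale span_base)
  qed (use assms(1) in \<open>auto simp: independent_insert\<close>)
qed

text \<open>The count of eigenvalues is 1 at 0 and reaches 2 only at \<open>lam\<close>, so knowing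
  the spectrum up to \<open>lam\<close> suffices.\<close>

lemma mu_2_eqI:
  assumes "0 < lam" and ev: "\<And>\<nu>. \<nu> \<le> lam \<Longrightarrow> \<nu> \<in> eigenvalues G L \<longleftrightarrow> \<nu> = 0 \<or> \<nu> = lam"
    and "eigen_multiplicity G L 0 = 1" "eigen_multiplicity G L lam = 1"
  shows "mu G L 2 = lam"
  unfolding mu_def
proof (rule Least_equality)
  have "{\<nu>. \<nu> \<in> eigenvalues G L \<and> \<nu> \<le> lam} = {0, lam}"
    using ev \<open>0 < lam\<close> by auto
  then show "lam \<in> eigenvalues G L \<and>
      2 \<le> (\<Sum>\<nu> | \<nu> \<in> eigenvalues G L \<and> \<nu> \<le> lam. eigen_multiplicity G L \<nu>)"
    using assms by simp
next
  fix \<kappa> assume \<kappa>: "\<kappa> \<in> eigenvalues G L \<and>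
      2 \<le> (\<Sum>\<nu> | \<nu> \<in> eigenvalues G L \<and> \<nu> \<le> \<kappa>. eigen_multiplicity G L \<nu>)"
  show "lam \<le> \<kappa>"
  proof (rule ccontr)
    assume "\<not> lam \<le> \<kappa>"
    then have "\<kappa> = 0"
      using \<kappa> ev[of \<kappa>] by auto
    then have "{\<nu>. \<nu> \<in> eigenvalues G L \<and> \<nu> \<le> \<kappa>} = {0}"
      using ev \<open>0 < lam\<close> \<kappa> by auto
    then show False
      using \<kappa> assms by simp
  qed
qed

section \<open>Trees\<close>

text \<open>A closed walk crosses each cut an even number of times, hence it cannot use an edge that is a
  cut on its own just once.\<close>

lemma no_undirected_cycle:
  assumes cut: "\<And>e e'. e \<in> arcs G \<Longrightarrow> e' \<in> arcs G \<Longrightarrow>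
    (side e (tail G e') \<noteq> side e (head G e')) \<longleftrightarrow> e' = e"
  shows "\<not> undirected_cycle G p"
proof
  assume "undirected_cycle G p"
  then obtain u where p: "set p \<subseteq> arcs (doubled G)" "pre_digraph.cas (doubled G) u p u"
    "distinct (map fst p)" "p \<noteq> []"
    by (auto simp: undirected_cycle_def pre_digraph.cycle_def pre_digraph.awalk_def)
  \<comment> \<open>Generalised to open walks for the induction. As the edges are distinct,
    \<open>e\<close> is crossed at most once, so the side changes exactly if \<open>e\<close>
    occurs; a closed walk cannot change sides.\<close>
  have crossing: "side e u \<noteq> side e v \<longleftrightarrow> e \<in> fst ` set p"
    if "e \<in> arcs G" "set p \<subseteq> arcs (doubled G)" "pre_digraph.cas (doubled G) u p v"
      "distinct (map fst p)" for e u v p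
    using that(2-)
  proof (induction p arbitrary: u)
    case Nil
    then show ?case
      by (simp add: pre_digraph.cas.simps)
  next
    case (Cons a p)
    obtain e' b where a: "a = (e', b)"
      by fastforce
    have IH: "side e (head (doubled G) a) \<noteq> side e v \<longleftrightarrow> e \<in> fst ` set p"
      using Cons by (intro Cons.IH) (auto simp: pre_digraph.cas.simps)
    have "side e (tail (doubled G) a) \<noteq> side e (head (doubled G) a) \<longleftrightarrow> e' = e"
      using cut[OF that(1), of e'] Cons.prems(1) by (auto simp: a doubled_def)
    moreover have "e' \<notin> fst ` set p" "u = tail (doubled G) a"
      using Cons.prems(2,3) by (auto simp: a pre_digraph.cas.simps)
    ultimately show ?case
      using IH by (auto simp: a)
  qed
  obtain a where "a \<in> set p"
    using \<open>p \<noteq> []\<close> by (cases p) auto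
  moreover have "fst a \<in> arcs G"
    using p(1) \<open>a \<in> set p\<close> by (auto simp: doubled_def)
  ultimately show False
    using crossing[OF _ p(1-3), of "fst a"] by simp
qed

section \<open>The tree\<close>

text \<open>Vertex \<open>0\<close> is the root. The vertices \<open>1\<close> and \<open>2\<close> are the centres of two stars with \<open>n\<^sup>2\<close> leaves
  each, and \<open>3\<close> is the far end of the long edge. An edge is named after its lower end.\<close>

definition parent :: "nat \<Rightarrow> nat \<Rightarrow> nat" where
  "parent n v = (if v < 4 then 0 else if v < 4 + n * n then 1 else 2)"

text \<open>All edges point towards the root. The parameter thus starts at the lower end, and the
  Kirchhoff condition at a leaf says that the initial slope vanishes.\<close>

definition dumbbell :: "nat \<Rightarrow> (nat, nat) pre_digraph" where
  "dumbbell n = \<lparr> verts = {..<4 + 2 * (n * n)}, arcs = {1..<4 + 2 * (n * n)},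
    tail = (\<lambda>e. e), head = parent n \<rparr>"

text \<open>The long edge is chosen such that its far end has distance (1 - 2/n) + 2/n = 1 from the
  leaves of the stars.\<close>

definition edge_len :: "nat \<Rightarrow> nat \<Rightarrow> real" where
  "edge_len n e = (if e = 3 then 1 - 2 / real n else 1 / real n)"

lemma dumbbell_simps [simp]:
  "verts (dumbbell n) = {..<4 + 2 * (n * n)}"
  "arcs (dumbbell n) = {1..<4 + 2 * (n * n)}"
  "tail (dumbbell n) e = e"
  "head (dumbbell n) e = parent n e"
  by (simp_all add: dumbbell_def)

lemma dumbbell_connected: "Digraph_Component.connected (dumbbell n)"
proof -
  let ?V = "verts (dumbbell n)" and ?R = "(arcs_ends (dumbbell n))\<^sup>s"
  interpret wf_digraph "dumbbell n"
    by unfold_locales (auto simp: parent_def)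
  have step: "(v, parent n v) \<in> rtrancl_on ?V ?R \<and> (parent n v, v) \<in> rtrancl_on ?V ?R"
    if v: "v \<in> ?V" for v
  proof (cases "v = 0")
    case True
    then show ?thesis
      by (auto simp: parent_def)
  next
    case False
    then have "(v, parent n v) \<in> ?R" "(parent n v, v) \<in> ?R"
      using v by (force simp: symcl_def arcs_ends_def arc_to_ends_def)+
    moreover have "parent n v \<in> ?V"
      by (auto simp: parent_def)
    ultimately show ?thesis
      using v rtrancl_on.rtrancl_on_refl rtrancl_on.rtrancl_on_into_rtrancl_on by metis
  qed
  have root: "(v, 0) \<in> rtrancl_on ?V ?R \<and> (0, v) \<in> rtrancl_on ?V ?R" if v: "v \<in> ?V" for v
  proof -
    \<comment> \<open>The tree has depth two and the root is its own parent, so two steps always end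
      at the root.\<close>
    have "parent n v \<in> ?V" "parent n (parent n v) = 0"
      by (auto simp: parent_def)
    then show ?thesis
      using step[OF v] step[of "parent n v"] by (metis rtrancl_on_trans)
  qed
  then show ?thesis
    unfolding connected_conv by (metis rtrancl_on_trans dumbbell_simps(1) lessThan_iff
      empty_iff zero_less_numeral add_pos_nonneg zero_le)
qed

text \<open>The bound on \<open>n\<close> makes the long edge positive and gives 4/n \<le> 1, so
  that the part formed by the short edges does not exceed the diameter 1.\<close>

locale dumbbell_tree =
  fixes n :: nat
  assumes n_ge_4: "4 \<le> n"
begin

abbreviation "G \<equiv> dumbbell n"
abbreviation "L \<equiv> edge_len n"

lemma edge_len_pos: "0 < L e"
  using n_ge_4 by (auto simp: edge_len_def field_simps)

sublocale metric_tree G L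
proof unfold_locales
  show "\<nexists>p. undirected_cycle G p"
  proof (rule notI, elim exE)
    fix p assume "undirected_cycle G p"
    moreover have "\<not> undirected_cycle G p"
      \<comment> \<open>The cut belonging to \<open>e\<close> separates the subtree below
        \<open>e\<close>, which consists of \<open>e\<close> and its children, from the
        rest.\<close>
      by (rule no_undirected_cycle[of G "\<lambda>e v. v = e \<or> parent n v = e"])
        (auto simp: parent_def split: if_splits)
    ultimately show False
      by blast
  qed
qed (use dumbbell_connected edge_len_pos in \<open>auto simp: parent_def\<close>)

lemma point_on_edge:
  assumes "x \<in> points G L"
  obtains e s where "e \<in> arcs G" "s \<in> {0..L e}" "x = on_edge G L e s"
proof (cases x)
  case (Vertex v)
  show thesis
  proof (cases "v = 0")
    case True
    \<comment> \<open>The root is the tail of no edge; it is represented as the upper end of edge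
      1.\<close>
    then show thesis
      using Vertex edge_len_pos[of 1] by (intro that[of 1 "L 1"]) (auto simp: on_edge_def parent_def)
  next
    case False
    then show thesis
      using Vertex assms edge_len_pos[of v] by (intro that[of v 0]) (auto simp: points_def)
  qed
next
  case (Interior e s)
  then show thesis
    using assms by (intro that[of e s]) (auto simp: points_def on_edge_def)
qed

text \<open>The value at a vertex is read off at the start of the edge named after it. No edge
  starts at the root, whose value \<open>r\<close> is therefore a separate argument.\<close>

definition build :: "real \<Rightarrow> (nat \<Rightarrow> real \<Rightarrow> real) \<Rightarrow> (nat, nat) point \<Rightarrow> real" where
  "build r \<phi> = glue G L (\<lambda>v. if v = 0 then r else \<phi> v 0) \<phi>"

lemma build_on_edge:
  assumes "e \<in> arcs G" "s \<in> {0..L e}"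
    and "\<And>e. 1 \<le> e \<Longrightarrow> e < 4 \<Longrightarrow> \<phi> e (L e) = r"
    and "\<And>e. 4 \<le> e \<Longrightarrow> e < 4 + 2 * (n * n) \<Longrightarrow> \<phi> e (1 / n) = \<phi> (parent n e) 0"
  shows "build r \<phi> (on_edge G L e s) = \<phi> e s"
  unfolding build_def using assms(1,2)
proof (rule glue_on_edge)
  show "\<phi> e (L e) = (if head G e = 0 then r else \<phi> (head G e) 0)"
    using assms(1) assms(3,4)[of e] by (cases "e < 4") (auto simp: parent_def edge_len_def)
qed (use assms(1) in auto)

lemma build_outside: "x \<notin> points G L \<Longrightarrow> build r \<phi> x = 0"
  by (simp add: build_def glue_def)

subsection \<open>Diameter\<close>

lemma path_to_root:
  assumes "e \<in> arcs G" "s \<in> {0..L e}"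
  shows "path_length G L (on_edge G L e s) (L e - s + (if e < 4 then 0 else 1 / n)) (Vertex 0)"
proof -
  have up: "path_length G L (on_edge G L e s) (L e - s) (Vertex (parent n e))"
    if "e \<in> arcs G" "s \<in> {0..L e}" for e s
    using path_length_on_edge[OF that, of "L e"] on_edge_head[OF that(1)] that(2) by simp
  show ?thesis
  proof (cases "e < 4")
    case True
    then show ?thesis
      using up[OF assms] by (simp add: parent_def)
  next
    case False
    define p where "p = parent n e"
    have p: "p \<in> arcs G" "p < 4" "p \<noteq> 3"
      using False by (auto simp: p_def parent_def)
    have "path_length G L (Vertex p) (1 / n) (Vertex 0)"
      using up[OF p(1), of 0] p edge_len_pos[of p] by (simp add: parent_def edge_len_def)
    then show ?thesis
      using path_length_trans up[OF assms] False by (auto simp: p_def)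
  qed
qed

lemma graph_dist_via_root:
  assumes "path_length G L x r (Vertex 0)" "path_length G L y q (Vertex 0)"
  shows "graph_dist G L x y \<le> r + q"
  using path_length_trans[OF path_length_sym[OF assms(2)] assms(1)] by (rule graph_dist_le)

lemma graph_dist_short_edges:
  assumes "e \<in> arcs G" "s \<in> {0..L e}" "e' \<in> arcs G" "s' \<in> {0..L e'}" "e \<noteq> 3" "e' \<noteq> 3"
  shows "graph_dist G L (on_edge G L e s) (on_edge G L e' s') \<le> 4 / n"
proof -
  have "0 < 1 / real n"
    using n_ge_4 by simp
  then show ?thesis
    using graph_dist_via_root[OF path_to_root[OF assms(1,2)] path_to_root[OF assms(3,4)]] assms
    by (auto simp: edge_len_def split: if_splits)
qed

lemma graph_dist_le_1:
  assumes "x \<in> points G L" "y \<in> points G L"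
  shows "graph_dist G L x y \<le> 1"
proof -
  obtain e s where x: "e \<in> arcs G" "s \<in> {0..L e}" "x = on_edge G L e s"
    using assms(1) by (rule point_on_edge)
  obtain e' s' where y: "e' \<in> arcs G" "s' \<in> {0..L e'}" "y = on_edge G L e' s'"
    using assms(2) by (rule point_on_edge)
  have n: "0 < 1 / real n" "4 / real n \<le> 1"
    using n_ge_4 by auto
  consider "e = 3" "e' = 3" | "e \<noteq> 3" "e' \<noteq> 3" | "(e = 3) \<noteq> (e' = 3)"
    by auto
  then show ?thesis
  proof cases
    case 1
    have "\<bar>s' - s\<bar> \<le> 1"
      using x(2) y(2) 1 n(1) unfolding edge_len_def by (auto simp del: zero_less_divide_1_iff of_nat_0_less_iff)
    then show ?thesis
      using graph_dist_le[OF path_length_on_edge[OF x(1,2), of s']] x y 1 by auto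
  next
    case 2
    then show ?thesis
      using order_trans[OF graph_dist_short_edges[OF x(1,2) y(1,2)] n(2)] x(3) y(3) by blast
  next
    case 3
    \<comment> \<open>Via the root, the long edge contributes at most 1 - 2/n and the other point at
      most 2/n.\<close>
    then show ?thesis
      using graph_dist_via_root[OF path_to_root[OF x(1,2)] path_to_root[OF y(1,2)]] x y n
      by (auto simp: edge_len_def split: if_splits)
  qed
qed

lemma diameter: "has_max (distances G L (points G L)) 1"
proof -
  \<comment> \<open>The signed distance from the root, negative on the long edge. It is 1-Lipschitz
    and differs by 1 between the vertices 3 and 4, which bounds their distance from below.\<close>
  define \<phi> where "\<phi> e s = (if e = 3 then s - (1 - 2 / n) else if e < 4 then 1 / n - s else 2 / n - s)"
    for e :: nat and s :: real
  have F: "build 0 \<phi> (on_edge G L e s) = \<phi> e s" if "e \<in> arcs G" "s \<in> {0..L e}" for e s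
    using that by (rule build_on_edge) (auto simp: \<phi>_def edge_len_def parent_def)
  have n: "0 < n * n" "0 < 1 / real n"
    using n_ge_4 by auto
  have pts: "Vertex 3 \<in> points G L" "Vertex 4 \<in> points G L"
    using n by (auto simp: points_def)
  obtain r where "path_length G L (Vertex 3) r (Vertex 4)"
    using ex_path_length[OF pts] by blast
  then have "\<bar>build 0 \<phi> (Vertex 4) - build 0 \<phi> (Vertex 3)\<bar> \<le> 1 * graph_dist G L (Vertex 3) (Vertex 4)"
  proof (rule lipschitz_graph_dist)
    show "\<bar>build 0 \<phi> (on_edge G L e t) - build 0 \<phi> (on_edge G L e s)\<bar> \<le> 1 * \<bar>t - s\<bar>"
      if "e \<in> arcs G" "s \<in> {0..L e}" "t \<in> {0..L e}" for e s t
      unfolding F[OF that(1,2)] F[OF that(1,3)] by (simp add: \<phi>_def abs_minus_commute)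
  qed simp
  moreover have "build 0 \<phi> (Vertex 4) = 2 / n" "build 0 \<phi> (Vertex 3) = - (1 - 2 / n)"
    using F[of 4 0] F[of 3 0] n edge_len_pos[of 3] edge_len_pos[of 4] by (auto simp: \<phi>_def)
  ultimately have "1 \<le> graph_dist G L (Vertex 3) (Vertex 4)"
    by simp
  then have "graph_dist G L (Vertex 3) (Vertex 4) = 1"
    using graph_dist_le_1[OF pts] by simp
  then show ?thesis
    using pts graph_dist_le_1 by (force simp: has_max_def distances_def)
qed

subsection \<open>The secular equation\<close>

lemma arcs_with_head:
  "{e \<in> arcs G. head G e = 0} = {1, 2, 3}"
  "{e \<in> arcs G. head G e = 1} = {4..<4 + n * n}"
  "{e \<in> arcs G. head G e = 2} = {4 + n * n..<4 + 2 * (n * n)}"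
  "3 \<le> v \<Longrightarrow> {e \<in> arcs G. head G e = v} = {}"
  using n_ge_4 by (auto simp: parent_def split: if_splits)

lemma arcs_with_tail:
  "v \<in> verts G \<Longrightarrow> {e \<in> arcs G. tail G e = v} = (if v = 0 then {} else {v})"
  by auto

text \<open>Here \<open>p\<close> stands for the slopes at the heads and \<open>q\<close> for those
  at the tails. They are arbitrary, so that the equivalence serves both to extract equations from an
  eigenfunction and to verify the explicit mode.\<close>

lemma kirchhoff_dumbbell:
  "(\<forall>v\<in>verts G. (\<Sum>e | e \<in> arcs G \<and> head G e = v. p e) = (\<Sum>e | e \<in> arcs G \<and> tail G e = v. q e))
    \<longleftrightarrow> p 1 + p 2 + p 3 = 0 \<and> (\<Sum>e = 4..<4 + n * n. p e) = q 1 \<and>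
      (\<Sum>e = 4 + n * n..<4 + 2 * (n * n). p e) = q 2 \<and> (\<forall>e\<in>{3..<4 + 2 * (n * n)}. q e = 0)"
  (is "(\<forall>v\<in>_. ?P v) \<longleftrightarrow> ?R")
proof -
  have "verts G = {0, 1, 2} \<union> {3..<4 + 2 * (n * n)}"
    by auto
  then have "(\<forall>v\<in>verts G. ?P v) \<longleftrightarrow>
      ?P 0 \<and> ?P 1 \<and> ?P 2 \<and> (\<forall>v\<in>{3..<4 + 2 * (n * n)}. ?P v)"
    by auto
  moreover have tail: "(\<Sum>e | e \<in> arcs G \<and> tail G e = v. q e) = (if v = 0 then 0 else q v)"
    if "v \<in> verts G" for v
    unfolding arcs_with_tail[OF that] by simp
  have "?P 0 \<longleftrightarrow> p 1 + p 2 + p 3 = 0"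
    by (subst tail) (simp, unfold arcs_with_head, simp add: add.assoc)
  moreover have "?P 1 \<longleftrightarrow> (\<Sum>e = 4..<4 + n * n. p e) = q 1"
    by (subst tail) (simp, unfold arcs_with_head, simp)
  moreover have "?P 2 \<longleftrightarrow> (\<Sum>e = 4 + n * n..<4 + 2 * (n * n). p e) = q 2"
    by (subst tail) (simp, unfold arcs_with_head, simp)
  moreover have "?P v \<longleftrightarrow> q v = 0" if v: "v \<in> {3..<4 + 2 * (n * n)}" for v
  proof -
    have "3 \<le> v" "v \<in> verts G"
      using v by auto
    then show ?thesis
      by (simp only: tail arcs_with_head(4)) auto
  qed
  ultimately show ?thesis
    by blast
qed

text \<open>The data are propagated from the leaves upwards, starting with slope 0. Leaves of one
  star share the value at their centre, so \<open>c \<noteq> 0\<close> makes their own values equal.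
  Their n^2 equal fluxes give the initial slope of the edge next to the root. What remains is a
  linear system in \<open>A\<close>, \<open>B\<close> and \<open>D\<close>: three expressions for
  the value at the root, and the balance of fluxes there.\<close>

lemma eigenspace_dumbbell:
  fixes f :: "(nat, nat) point \<Rightarrow> real" and lam :: real
    and d :: "nat \<Rightarrow> real" and c t A B D :: real
  defines "d \<equiv> \<lambda>e. edge_deriv G L f e 0"
    and "c \<equiv> cs lam (1 / n)" and "t \<equiv> sn lam (1 / n)"
    and "A \<equiv> f (Vertex 4)" and "B \<equiv> f (Vertex (4 + n * n))" and "D \<equiv> f (Vertex 3)"
  assumes f: "f \<in> eigenspace G L lam" and "c \<noteq> 0"
  shows "e \<in> {4..<4 + n * n} \<Longrightarrow> f (Vertex e) = A"
    and "e \<in> {4 + n * n..<4 + 2 * (n * n)} \<Longrightarrow> f (Vertex e) = B"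
    and "e \<in> {3..<4 + 2 * (n * n)} \<Longrightarrow> d e = 0"
    and "f (Vertex 1) = A * c" "f (Vertex 2) = B * c"
    and "d 1 = - lam * n\<^sup>2 * A * t" "d 2 = - lam * n\<^sup>2 * B * t"
    and "f (Vertex 0) = A * (c\<^sup>2 - lam * n\<^sup>2 * t\<^sup>2)" "f (Vertex 0) = B * (c\<^sup>2 - lam * n\<^sup>2 * t\<^sup>2)"
    and "f (Vertex 0) = D * cs lam (1 - 2 / n)"
    and "lam * ((n\<^sup>2 + 1) * (A + B) * c * t + D * sn lam (1 - 2 / n)) = 0"
proof -
  have nn: "0 < n * n"
    using n_ge_4 by simp
  have head: "f (Vertex (parent n e)) = f (Vertex e) * cs lam (L e) + d e * sn lam (L e)"
    if "e \<in> arcs G" for e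
    using eigenspace_on_edge(1)[OF f that, of "L e"] on_edge_head[OF that] edge_len_pos[of e]
    by (simp add: d_def)
  have deriv: "edge_deriv G L f e (L e) = - lam * f (Vertex e) * sn lam (L e) + d e * cs lam (L e)"
    if "e \<in> arcs G" for e
    using eigenspace_on_edge(2)[OF f that, of "L e"] edge_len_pos[of e] by (simp add: d_def)
  have "kirchhoff G L f"
    using f by (simp add: eigenspace_def standard_laplacian_def laplacian_domain_def)
  then have "\<forall>v\<in>verts G. (\<Sum>e | e \<in> arcs G \<and> head G e = v. edge_deriv G L f e (L e))
      = (\<Sum>e | e \<in> arcs G \<and> tail G e = v. d e)"
    by (simp add: kirchhoff_def d_def)
  note kir = this[unfolded kirchhoff_dumbbell]
  show d0: "d e = 0" if "e \<in> {3..<4 + 2 * (n * n)}" for e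
    using kir that by blast
  have leaf: "f (Vertex (parent n e)) = f (Vertex e) * c" if "e \<in> {4..<4 + 2 * (n * n)}" for e
    using head[of e] d0[of e] that by (auto simp: c_def edge_len_def)
  show 1: "f (Vertex 1) = A * c" and 2: "f (Vertex 2) = B * c"
    using leaf[of 4] leaf[of "4 + n * n"] nn by (auto simp: A_def B_def parent_def)
  show A: "f (Vertex e) = A" if "e \<in> {4..<4 + n * n}" for e
    using leaf[of e] that 1 \<open>c \<noteq> 0\<close> by (auto simp: parent_def)
  show B: "f (Vertex e) = B" if "e \<in> {4 + n * n..<4 + 2 * (n * n)}" for e
    using leaf[of e] that 2 \<open>c \<noteq> 0\<close> by (auto simp: parent_def)
  have "(\<Sum>e = 4..<4 + n * n. edge_deriv G L f e (L e)) = (\<Sum>e = 4..<4 + n * n. - lam * A * t)"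
  proof (rule sum.cong)
    fix e assume "e \<in> {4..<4 + n * n}"
    then show "edge_deriv G L f e (L e) = - lam * A * t"
      using deriv[of e] d0[of e] A[of e] by (auto simp: t_def edge_len_def)
  qed simp
  then show d1: "d 1 = - lam * n\<^sup>2 * A * t"
    using kir by (simp add: power2_eq_square)
  have "(\<Sum>e = 4 + n * n..<4 + 2 * (n * n). edge_deriv G L f e (L e))
      = (\<Sum>e = 4 + n * n..<4 + 2 * (n * n). - lam * B * t)"
  proof (rule sum.cong)
    fix e assume "e \<in> {4 + n * n..<4 + 2 * (n * n)}"
    then show "edge_deriv G L f e (L e) = - lam * B * t"
      using deriv[of e] d0[of e] B[of e] by (auto simp: t_def edge_len_def)
  qed simp
  then show d2: "d 2 = - lam * n\<^sup>2 * B * t"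
    using kir by (simp add: power2_eq_square)
  have "f (Vertex 0) = f (Vertex 1) * c + d 1 * t" "f (Vertex 0) = f (Vertex 2) * c + d 2 * t"
    using head[of 1] head[of 2] by (auto simp: parent_def edge_len_def c_def t_def)
  then show "f (Vertex 0) = A * (c\<^sup>2 - lam * n\<^sup>2 * t\<^sup>2)" "f (Vertex 0) = B * (c\<^sup>2 - lam * n\<^sup>2 * t\<^sup>2)"
    by (simp_all only: 1 2 d1 d2) (simp_all add: algebra_simps power2_eq_square)
  show "f (Vertex 0) = D * cs lam (1 - 2 / n)"
    using head[of 3] d0[of 3] by (auto simp: parent_def edge_len_def D_def)
  have "edge_deriv G L f 1 (L 1) = - lam * (A * c) * t + d 1 * c"
    "edge_deriv G L f 2 (L 2) = - lam * (B * c) * t + d 2 * c"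
    "edge_deriv G L f 3 (L 3) = - lam * D * sn lam (1 - 2 / n)"
    using deriv[of 1] deriv[of 2] deriv[of 3] d0[of 3] 1 2
    by (auto simp: edge_len_def c_def t_def D_def)
  \<comment> \<open>Each edge next to the root carries its own contribution and that of its n^2
    leaves, whence the factor n^2 + 1.\<close>
  then have "(- lam * (A * c) * t + d 1 * c) + (- lam * (B * c) * t + d 2 * c)
      - lam * D * sn lam (1 - 2 / n) = 0"
    using kir by simp
  then show "lam * ((n\<^sup>2 + 1) * (A + B) * c * t + D * sn lam (1 - 2 / n)) = 0"
    by (simp only: d1 d2) (simp add: algebra_simps)
qed

text \<open>All vertex values and initial slopes are multiples of these three leaf values, so the
  eigenspaces can be computed in three coordinates.\<close>

lemma eigenspace_dumbbell_eqI:
  assumes "f \<in> eigenspace G L lam" "g \<in> eigenspace G L lam" "cs lam (1 / n) \<noteq> 0"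
    and "f (Vertex 3) = g (Vertex 3)" "f (Vertex 4) = g (Vertex 4)"
    and "f (Vertex (4 + n * n)) = g (Vertex (4 + n * n))"
  shows "f = g"
proof (rule eigenspace_eqI[OF assms(1,2)])
  note ef = eigenspace_dumbbell[OF assms(1,3)]
  note eg = eigenspace_dumbbell[OF assms(2,3)]
  show "f (Vertex v) = g (Vertex v)" if v: "v \<in> verts G" for v
  proof -
    consider "v = 0" | "v = 1" | "v = 2" | "v = 3" | "v \<in> {4..<4 + n * n}"
      | "v \<in> {4 + n * n..<4 + 2 * (n * n)}"
      using v unfolding dumbbell_simps lessThan_iff atLeastLessThan_iff by linarith
    then show ?thesis
    proof cases
      case 1
      then show ?thesis using ef(10) eg(10) assms(4) by simp
    next
      case 2
      then show ?thesis using ef(4) eg(4) assms(5) by simp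
    next
      case 3
      then show ?thesis using ef(5) eg(5) assms(6) by simp
    next
      case 5
      then show ?thesis using ef(1) eg(1) assms(5) by simp
    next
      case 6
      then show ?thesis using ef(2) eg(2) assms(6) by simp
    qed (use assms(4) in simp)
  qed
  show "edge_deriv G L f e 0 = edge_deriv G L g e 0" if e: "e \<in> arcs G" for e
  proof -
    consider "e = 1" | "e = 2" | "e \<in> {3..<4 + 2 * (n * n)}"
      using e unfolding dumbbell_simps atLeastLessThan_iff by linarith
    then show ?thesis
    proof cases
      case 1
      then show ?thesis using ef(6) eg(6) assms(5) by simp
    next
      case 2
      then show ?thesis using ef(7) eg(7) assms(6) by simp
    next
      case 3
      then show ?thesis using ef(3) eg(3) by simp
    qed
  qed
qed

subsection \<open>The first two eigenvalues\<close>

definition freq :: real where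
  "freq = n * arctan (1 / n)"

lemma freq_div: "freq / n = arctan (1 / n)"
  using n_ge_4 by (simp add: freq_def)

lemma freq_pos: "0 < freq"
  using n_ge_4 by (simp add: freq_def)

lemma freq_le_1: "freq \<le> 1"
proof -
  have "arctan (1 / n) \<le> 1 / n"
    by (rule arctan_le_self) simp
  then show ?thesis
    using n_ge_4 by (simp add: freq_def field_simps)
qed

lemma freq_div_bounds: "0 < freq / n" "freq / n < pi / 2"
  using n_ge_4 arctan_ubound unfolding freq_div by auto

text \<open>This is tan (freq / n) = 1/n cleared of denominators. In this form it yields continuity
  of the mode at the star centres, the Kirchhoff condition there (multiply by \<open>n\<close>), and
  the vanishing of the root factor.\<close>

lemma n_sin_freq: "n * sin (freq / n) = cos (freq / n)"
proof -
  have "cos (freq / n) \<noteq> 0"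
    unfolding freq_div by (rule cos_arctan_not_zero)
  moreover have "tan (freq / n) = 1 / n"
    unfolding freq_div by (rule tan_arctan)
  ultimately show ?thesis
    using n_ge_4 by (simp add: tan_def field_simps)
qed

text \<open>For positive \<open>lam\<close> frequency and length are at most 1 < pi/2, so the
  arguments stay inside the first quarter period. Otherwise the functions are hyperbolic or
  linear.\<close>

lemma cs_sn_pos:
  assumes "lam \<le> freq\<^sup>2" "0 < s" "s \<le> 1"
  shows "0 < cs lam s" "0 < sn lam s"
proof -
  have "0 < cs lam s \<and> 0 < sn lam s"
  proof (cases "lam \<le> 0")
    case True
    then show ?thesis
      using cs_nonpos_ge_1[of lam s] sn_nonpos_pos[of lam s] assms by simp
  next
    case False
    then have "0 < sqrt lam" "sqrt lam \<le> freq"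
      using assms freq_pos by (auto intro: real_le_lsqrt)
    then have "0 < sqrt lam * s" "sqrt lam * s \<le> 1 * 1"
      using assms freq_le_1 by (simp, intro mult_mono) linarith+
    then have "0 < sqrt lam * s" "sqrt lam * s < pi / 2"
      using pi_gt3 by auto
    then have "0 < cos (sqrt lam * s)" "0 < sin (sqrt lam * s)"
      by (auto intro!: cos_gt_zero sin_gt_zero2)
    then show ?thesis
      using False \<open>0 < sqrt lam\<close> by (simp add: cs_def sn_def)
  qed
  then show "0 < cs lam s" "0 < sn lam s"
    by auto
qed

text \<open>The factor is the ratio of the value at the root to the value at a star leaf. For
  positive \<open>lam\<close> it equals cos^2 x - (n sin x)^2; since cos x decreases, n sin x
  increases and the two meet at x = freq / n, it is positive before that point.\<close>

lemma root_factor_pos: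
  fixes lam :: real
  assumes "lam < freq\<^sup>2"
  shows "0 < (cs lam (1 / n))\<^sup>2 - lam * n\<^sup>2 * (sn lam (1 / n))\<^sup>2"
proof (cases "lam \<le> 0")
  case True
  have "1 \<le> (cs lam (1 / n))\<^sup>2"
    using cs_nonpos_ge_1[OF True, of "1 / n"] by (simp add: one_le_power)
  moreover have "lam * n\<^sup>2 * (sn lam (1 / n))\<^sup>2 \<le> 0"
    using True by (simp add: mult_nonpos_nonneg)
  ultimately show ?thesis
    by simp
next
  case False
  define x where "x = sqrt lam / n"
  have "sqrt lam < freq"
    using assms freq_pos by (simp add: real_less_lsqrt)
  then have x: "0 < x" "x < freq / n"
    using False n_ge_4 by (auto simp: x_def divide_strict_right_mono)
  have "n * sin x < n * sin (freq / n)"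
    using x freq_div_bounds n_ge_4 by (intro mult_strict_left_mono sin_monotone_2pi) linarith+
  also have "\<dots> < cos x"
    using x freq_div_bounds unfolding n_sin_freq by (intro cos_monotone_0_pi) linarith+
  finally have "n * sin x < cos x" .
  moreover have "0 \<le> n * sin x"
    using x freq_div_bounds by (intro mult_nonneg_nonneg sin_ge_zero) linarith+
  ultimately have "(n * sin x)\<^sup>2 < (cos x)\<^sup>2"
    by (intro power_strict_mono) auto
  then show ?thesis
    using False by (simp add: cs_def sn_def x_def power_mult_distrib power_divide)
qed

section \<open>Eigenspaces up to the second eigenvalue\<close>

lemma constants_in_eigenspace_0: "fun_scale t (build 1 (\<lambda>_ _. 1)) \<in> eigenspace G L 0"
proof (rule eigenspaceI[where \<phi> = "\<lambda>_ _. t" and \<phi>' = "\<lambda>_ _. 0" and K = 0])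
  show "fun_scale t (build 1 (\<lambda>_ _. 1)) (on_edge G L e s) = t" if "e \<in> arcs G" "s \<in> {0..L e}" for e s
    using build_on_edge[OF that, of "\<lambda>_ _. 1" 1] by (simp add: fun_scale_def)
qed (auto simp: fun_scale_def build_outside)

lemma zero_in_eigenspace: "0 \<in> eigenspace G L lam"
  by (rule eigenspaceI[where \<phi> = "\<lambda>_ _. 0" and \<phi>' = "\<lambda>_ _. 0" and K = 0]) auto

text \<open>The positive root factor forces A = B and D = A q with q > 0. The flux balance then
  reads A times a positive number equals 0. Negative \<open>lam\<close> is covered as well.\<close>

lemma eigenspace_trivial:
  assumes "lam < freq\<^sup>2" "lam \<noteq> 0" and f: "f \<in> eigenspace G L lam"
  shows "f = 0"
proof -
  define A D where "A = f (Vertex 4)" and "D = f (Vertex 3)"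
  define p where "p = (cs lam (1 / n))\<^sup>2 - lam * n\<^sup>2 * (sn lam (1 / n))\<^sup>2"
  have p: "0 < p"
    using root_factor_pos[OF assms(1)] by (simp add: p_def)
  have n: "0 < 1 / real n" "1 / real n \<le> 1" "0 < 1 - 2 / real n" "1 - 2 / real n \<le> 1"
    using n_ge_4 by auto
  note short = cs_sn_pos[of lam "1 / n"] and long = cs_sn_pos[of lam "1 - 2 / n"]
  have pos: "0 < cs lam (1 / n)" "0 < sn lam (1 / n)" "0 < cs lam (1 - 2 / n)" "0 < sn lam (1 - 2 / n)"
    using short long n assms(1) by auto
  then have c: "cs lam (1 / n) \<noteq> 0"
    by simp
  note e = eigenspace_dumbbell[OF f c]
  have B: "f (Vertex (4 + n * n)) = A"
    using e(8,9) p by (simp add: A_def p_def)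
  define q where "q = p / cs lam (1 - 2 / n)"
  have "0 < q"
    using p pos by (simp add: q_def)
  have D: "D = A * q"
    using e(8,10) pos by (simp add: A_def D_def p_def q_def field_simps)
  have "real (n\<^sup>2 + 1) * (A + A) * cs lam (1 / n) * sn lam (1 / n) + D * sn lam (1 - 2 / n) = 0"
    using e(11) assms(2) by (simp only: B A_def[symmetric] D_def[symmetric]) simp
  then have "A * (2 * real (n\<^sup>2 + 1) * cs lam (1 / n) * sn lam (1 / n) + q * sn lam (1 - 2 / n)) = 0"
    unfolding D by (simp add: algebra_simps)
  moreover have "0 < 2 * real (n\<^sup>2 + 1) * cs lam (1 / n) * sn lam (1 / n) + q * sn lam (1 - 2 / n)"
  proof -
    have "0 < real (n\<^sup>2 + 1)"
      by (simp only: of_nat_0_less_iff)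
    then show ?thesis
      using pos \<open>0 < q\<close> by (intro add_pos_pos mult_pos_pos) auto
  qed
  ultimately have "A = 0"
    by (simp only: mult_eq_0_iff) simp
  then show ?thesis
    using B D by (intro eigenspace_dumbbell_eqI[OF f zero_in_eigenspace c]) (auto simp: A_def D_def)
qed

lemma build_at_vertices:
  assumes "\<And>e. 1 \<le> e \<Longrightarrow> e < 4 \<Longrightarrow> \<phi> e (L e) = r"
    and "\<And>e. 4 \<le> e \<Longrightarrow> e < 4 + 2 * (n * n) \<Longrightarrow> \<phi> e (1 / n) = \<phi> (parent n e) 0"
    and "v \<in> arcs G"
  shows "build r \<phi> (Vertex v) = \<phi> v 0"
proof -
  have "build r \<phi> (on_edge G L v 0) = \<phi> v 0"
    using assms edge_len_pos[of v] by (intro build_on_edge) auto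
  then show ?thesis
    by simp
qed

lemma leaf_arcs: "3 \<in> arcs G" "4 \<in> arcs G" "4 + n * n \<in> arcs G"
  using n_ge_4 by auto

text \<open>At \<open>lam = 0\<close> the function \<open>cs\<close> is constantly 1, so each of the
  three leaf values equals the value at the root.\<close>

lemma eigenspace_0: "eigenspace G L 0 = range (\<lambda>t. fun_scale t (build 1 (\<lambda>_ _. 1)))"
proof (intro subset_antisym subsetI)
  fix f assume f: "f \<in> eigenspace G L 0"
  have c: "cs 0 s = 1" for s
    by (simp add: cs_def)
  have c0: "cs 0 (1 / n) \<noteq> 0"
    by (simp add: c)
  note e = eigenspace_dumbbell[OF f c0]
  have one: "build 1 (\<lambda>_ _. 1) (Vertex v) = 1" if "v \<in> arcs G" for v
    using that by (intro build_at_vertices) auto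
  have "f = fun_scale (f (Vertex 0)) (build 1 (\<lambda>_ _. 1))"
    using e(8,9,10) leaf_arcs
    by (intro eigenspace_dumbbell_eqI[OF f constants_in_eigenspace_0 c0])
      (auto simp: fun_scale_def one c)
  then show "f \<in> range (\<lambda>t. fun_scale t (build 1 (\<lambda>_ _. 1)))"
    by blast
qed (use constants_in_eigenspace_0 in auto)

text \<open>Normalised to 1 on the leaves of the first star and -1 on those of the second. The sine
  vanishes at the root, and its amplitude \<open>n\<close> matches the cosine at the star
  centre.\<close>

definition mode :: "nat \<Rightarrow> real \<Rightarrow> real" where
  "mode e s = (if e = 1 then n * sin (freq * (1 / n - s))
    else if e = 2 then - n * sin (freq * (1 / n - s))
    else if e = 3 then 0
    else if e < 4 + n * n then cos (freq * s) else - cos (freq * s))"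

definition mode' :: "nat \<Rightarrow> real \<Rightarrow> real" where
  "mode' e s = (if e = 1 then - freq * n * cos (freq * (1 / n - s))
    else if e = 2 then freq * n * cos (freq * (1 / n - s))
    else if e = 3 then 0
    else if e < 4 + n * n then - freq * sin (freq * s) else freq * sin (freq * s))"

lemma mode_compatible:
  shows "1 \<le> e \<Longrightarrow> e < 4 \<Longrightarrow> mode e (L e) = 0"
    and "4 \<le> e \<Longrightarrow> e < 4 + 2 * (n * n) \<Longrightarrow> mode e (1 / n) = mode (parent n e) 0"
proof -
  assume "1 \<le> e" "e < 4"
  then consider "e = 1" | "e = 2" | "e = 3"
    by linarith
  then show "mode e (L e) = 0"
    by cases (auto simp: mode_def edge_len_def)
next
  assume "4 \<le> e" "e < 4 + 2 * (n * n)"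
  then show "mode e (1 / n) = mode (parent n e) 0"
    using n_sin_freq by (auto simp: mode_def parent_def)
qed

lemma mode_derivatives:
  "(mode e has_real_derivative mode' e s) (at s)"
  "(mode' e has_real_derivative - freq\<^sup>2 * mode e s) (at s)"
  unfolding mode_def mode'_def
  by (auto intro!: derivative_eq_intros simp: algebra_simps power2_eq_square)

lemma mode'_bound: "\<bar>mode' e s\<bar> \<le> freq * n"
proof -
  have "1 * \<bar>x\<bar> \<le> n * 1" if "\<bar>x\<bar> \<le> 1" for x :: real
    using that n_ge_4 by linarith
  then have "freq * \<bar>sin x\<bar> \<le> freq * n" for x
    using freq_pos by simp
  moreover have "freq * n * \<bar>cos x\<bar> \<le> freq * n * 1" for x
    using freq_pos by (intro mult_left_mono) auto
  ultimately show ?thesis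
    using freq_pos by (auto simp: mode'_def abs_mult)
qed

text \<open>At the root the slopes of edges 1 and 2 cancel; at a star centre n^2 sin (freq / n) = n
  cos (freq / n) balances leaves and upper edge.\<close>

lemma mode_kirchhoff:
  assumes "v \<in> verts G"
  shows "(\<Sum>e | e \<in> arcs G \<and> head G e = v. mode' e (L e))
    = (\<Sum>e | e \<in> arcs G \<and> tail G e = v. mode' e 0)"
proof -
  have s: "(\<Sum>e = 4..<4 + n * n. mode' e (L e)) = (\<Sum>e = 4..<4 + n * n. - freq * sin (freq / n))"
    by (rule sum.cong) (auto simp: mode'_def edge_len_def)
  have s': "(\<Sum>e = 4 + n * n..<4 + 2 * (n * n). mode' e (L e))
      = (\<Sum>e = 4 + n * n..<4 + 2 * (n * n). freq * sin (freq / n))"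
    by (rule sum.cong) (auto simp: mode'_def edge_len_def)
  have "mode' 1 (L 1) + mode' 2 (L 2) + mode' 3 (L 3) = 0 \<and>
    (\<Sum>e = 4..<4 + n * n. mode' e (L e)) = mode' 1 0 \<and>
    (\<Sum>e = 4 + n * n..<4 + 2 * (n * n). mode' e (L e)) = mode' 2 0 \<and>
    (\<forall>e\<in>{3..<4 + 2 * (n * n)}. mode' e 0 = 0)"
    unfolding s s' using n_sin_freq by (auto simp: mode'_def edge_len_def)
  then show ?thesis
    using kirchhoff_dumbbell[of "\<lambda>e. mode' e (L e)" "\<lambda>e. mode' e 0"] assms by blast
qed

lemma mode_on_edge:
  assumes "e \<in> arcs G" "s \<in> {0..L e}"
  shows "build 0 mode (on_edge G L e s) = mode e s"
  using assms mode_compatible by (rule build_on_edge)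

lemma mode_Vertex: "v \<in> arcs G \<Longrightarrow> build 0 mode (Vertex v) = mode v 0"
  using mode_compatible by (rule build_at_vertices)

lemma mode_leaves:
  "build 0 mode (Vertex 3) = 0" "build 0 mode (Vertex 4) = 1"
  "build 0 mode (Vertex (4 + n * n)) = - 1"
  using n_ge_4 mode_Vertex[OF leaf_arcs(1)] mode_Vertex[OF leaf_arcs(2)] mode_Vertex[OF leaf_arcs(3)]
  by (auto simp: mode_def)

lemma mode_in_eigenspace: "fun_scale t (build 0 mode) \<in> eigenspace G L (freq\<^sup>2)"
proof (rule eigenspaceI)
  show "((\<lambda>s. t * mode e s) has_real_derivative t * mode' e s) (at s)" for e s
    using mode_derivatives(1) by (rule DERIV_cmult)
  show "((\<lambda>s. t * mode' e s) has_real_derivative - freq\<^sup>2 * (t * mode e s)) (at s)" for e s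
    using DERIV_cmult[OF mode_derivatives(2)[of e s], of t] by (simp add: mult.left_commute)
  show "\<bar>t * mode' e s\<bar> \<le> \<bar>t\<bar> * (freq * n)" for e s
    using mode'_bound[of e s] by (simp add: abs_mult mult_left_mono)
  show "(\<Sum>e | e \<in> arcs G \<and> head G e = v. t * mode' e (L e))
    = (\<Sum>e | e \<in> arcs G \<and> tail G e = v. t * mode' e 0)" if "v \<in> verts G" for v
    using mode_kirchhoff[OF that] by (simp only: sum_distrib_left[symmetric])
qed (auto simp: fun_scale_def build_outside mode_on_edge simp del: dumbbell_simps)

text \<open>Here the root factor vanishes, so the value at the root is 0. As \<open>cs\<close> is
  positive at the length of the long edge, D = 0 follows, and the flux balance reduces to A + B = 0.
  One free parameter remains.\<close>

lemma eigenspace_freq: "eigenspace G L (freq\<^sup>2) = range (\<lambda>t. fun_scale t (build 0 mode))"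
proof (intro subset_antisym subsetI)
  fix f assume f: "f \<in> eigenspace G L (freq\<^sup>2)"
  have cn: "cs (freq\<^sup>2) (1 / n) = cos (freq / n)" "sn (freq\<^sup>2) (1 / n) = sin (freq / n) / freq"
    using freq_pos by (auto simp: cs_def sn_def)
  have n: "0 < 1 / real n" "1 / real n \<le> 1" "0 < 1 - 2 / real n" "1 - 2 / real n \<le> 1"
    using n_ge_4 by auto
  have pos: "0 < cs (freq\<^sup>2) (1 / n)" "0 < sn (freq\<^sup>2) (1 / n)" "0 < cs (freq\<^sup>2) (1 - 2 / n)"
    using cs_sn_pos[OF order_refl, of "1 / n"] cs_sn_pos[OF order_refl, of "1 - 2 / n"] n
    by auto
  then have c: "cs (freq\<^sup>2) (1 / n) \<noteq> 0"
    by simp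
  note e = eigenspace_dumbbell[OF f c]
  have "(cs (freq\<^sup>2) (1 / n))\<^sup>2 - freq\<^sup>2 * n\<^sup>2 * (sn (freq\<^sup>2) (1 / n))\<^sup>2 = 0"
    unfolding cn n_sin_freq[symmetric] using freq_pos by (simp add: power_mult_distrib power_divide)
  then have D: "f (Vertex 3) = 0"
    using e(8,10) pos by simp
  have "freq\<^sup>2 * ((n\<^sup>2 + 1) * (f (Vertex 4) + f (Vertex (4 + n * n))) * cs (freq\<^sup>2) (1 / n) * sn (freq\<^sup>2) (1 / n)) = 0"
    using e(11) by (simp only: D) simp
  moreover have "real (n\<^sup>2 + 1) \<noteq> 0" "freq\<^sup>2 \<noteq> 0"
    using freq_pos by (simp_all only: of_nat_eq_0_iff) auto
  ultimately have "f (Vertex (4 + n * n)) = - f (Vertex 4)"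
    using pos by (simp only: mult_eq_0_iff) (auto simp: add_eq_0_iff)
  then have "f = fun_scale (f (Vertex 4)) (build 0 mode)"
    using D by (intro eigenspace_dumbbell_eqI[OF f mode_in_eigenspace c])
      (auto simp: fun_scale_def mode_leaves)
  then show "f \<in> range (\<lambda>t. fun_scale t (build 0 mode))"
    by blast
qed (use mode_in_eigenspace in auto)

lemma mode_nonzero: "build 0 mode \<noteq> 0"
  using mode_leaves(2) by auto

lemma one_nonzero: "build 1 (\<lambda>_ _. 1) \<noteq> 0"
proof -
  have "build 1 (\<lambda>_ _. 1) (Vertex 3) = 1"
    using leaf_arcs by (intro build_at_vertices) auto
  then show ?thesis
    by auto
qed

lemma eigen_multiplicity_freq: "eigen_multiplicity G L (freq\<^sup>2) = 1"
  using mode_nonzero eigenspace_freq by (rule eigen_multiplicity_eq_1)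

lemma mu_2: "mu G L 2 = freq\<^sup>2"
proof (rule mu_2_eqI)
  show "0 < freq\<^sup>2"
    using freq_pos by simp
  show "eigen_multiplicity G L 0 = 1"
    using one_nonzero eigenspace_0 by (rule eigen_multiplicity_eq_1)
  show "eigen_multiplicity G L (freq\<^sup>2) = 1"
    by (rule eigen_multiplicity_freq)
  show "\<nu> \<in> eigenvalues G L \<longleftrightarrow> \<nu> = 0 \<or> \<nu> = freq\<^sup>2" if "\<nu> \<le> freq\<^sup>2" for \<nu>
  proof
    assume "\<nu> \<in> eigenvalues G L"
    then show "\<nu> = 0 \<or> \<nu> = freq\<^sup>2"
      using that eigenspace_trivial[of \<nu>] by (force simp: eigenvalues_def eigenfunction_def)
  next
    have "eigenfunction G L 0 (build 1 (\<lambda>_ _. 1))" "eigenfunction G L (freq\<^sup>2) (build 0 mode)"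
      using constants_in_eigenspace_0[of 1] mode_in_eigenspace[of 1] mode_nonzero one_nonzero
      by (auto simp: eigenfunction_def fun_scale_def)
    moreover assume "\<nu> = 0 \<or> \<nu> = freq\<^sup>2"
    ultimately show "\<nu> \<in> eigenvalues G L"
      by (auto simp: eigenvalues_def)
  qed
qed

subsection \<open>Hot spots\<close>

text \<open>The excluded points are the star leaves. Off them the argument of the cosine lies
  strictly between 0 and pi/2, and on edges 1 and 2 the mode is bounded by its size at the star
  centre, n sin (freq / n) = cos (freq / n) < 1.\<close>

lemma mode_abs_less_1:
  assumes "e \<in> arcs G" "s \<in> {0..L e}" "\<not> (4 \<le> e \<and> s = 0)"
  shows "\<bar>mode e s\<bar> < 1"
proof -
  have n: "0 < real n"
    using n_ge_4 by simp
  have cos1: "0 \<le> cos (freq * s) \<and> cos (freq * s) < 1" if "0 < s" "s \<le> 1 / n" for s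
  proof -
    have "0 < freq * s" "freq * s \<le> freq * (1 / n)"
      using that freq_pos mult_left_mono[of s "1 / n" freq] by auto
    moreover have "freq * (1 / n) < pi / 2"
      using freq_div_bounds(2) by simp
    ultimately have "0 < freq * s" "freq * s < pi / 2"
      by linarith+
    then show ?thesis
      using cos_monotone_0_pi[of 0 "freq * s"] cos_gt_zero[of "freq * s"] by simp
  qed
  show ?thesis
  proof (cases "e = 1 \<or> e = 2")
    case True
    define x where "x = freq * (1 / n - s)"
    have "0 \<le> 1 / n - s" "1 / n - s \<le> 1 / n"
      using assms True by (auto simp: edge_len_def)
    then have "0 \<le> x" "x \<le> freq * (1 / n)"
      unfolding x_def using freq_pos mult_left_mono[of "1 / n - s" "1 / n" freq] by auto
    then have x: "0 \<le> x" "x \<le> freq / n"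
      by auto
    have "n * sin x \<le> n * sin (freq / n)"
      using x freq_div_bounds by (intro mult_left_mono sin_monotone_2pi_le) linarith+
    also have "\<dots> < 1"
      using cos1[of "1 / n"] n unfolding n_sin_freq by simp
    finally have "n * sin x < 1" .
    moreover have "0 \<le> n * sin x"
      using x freq_div_bounds by (intro mult_nonneg_nonneg sin_ge_zero) linarith+
    ultimately show ?thesis
      using True by (auto simp: mode_def x_def)
  next
    case False
    show ?thesis
    proof (cases "e = 3")
      case False
      then have "4 \<le> e" "0 < s" "s \<le> 1 / n"
        using assms \<open>\<not> (e = 1 \<or> e = 2)\<close> by (auto simp: edge_len_def)
      then show ?thesis
        using cos1[of s] by (auto simp: mode_def)
    qed (simp add: mode_def)
  qed
qed

lemma mode_abs_le_1:
  assumes "e \<in> arcs G" "s \<in> {0..L e}"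
  shows "\<bar>mode e s\<bar> \<le> 1"
  using mode_abs_less_1[OF assms] by (cases "4 \<le> e \<and> s = 0") (auto simp: mode_def)

lemma hot_spots_subset: "hot_spots G L \<subseteq> Vertex ` {4..<4 + 2 * (n * n)}"
proof
  fix x assume "x \<in> hot_spots G L"
  then obtain \<psi> where x: "x \<in> points G L" and \<psi>: "eigenfunction G L (freq\<^sup>2) \<psi>"
    and max: "\<And>y. y \<in> points G L \<Longrightarrow> \<psi> y \<le> \<psi> x"
    by (auto simp: hot_spots_def mu_2)
  obtain t where t: "\<psi> = fun_scale t (build 0 mode)"
    using \<psi> eigenspace_freq by (auto simp: eigenfunction_def)
  have "t \<noteq> 0"
    using \<psi> by (auto simp: t eigenfunction_def fun_scale_def fun_eq_iff)
  obtain e s where e: "e \<in> arcs G" "s \<in> {0..L e}" "x = on_edge G L e s"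
    using x by (rule point_on_edge)
  have "Vertex 4 \<in> points G L" "Vertex (4 + n * n) \<in> points G L"
    using leaf_arcs by (auto simp: points_def)
  \<comment> \<open>The mode is 1 and -1 at these two leaves, so the maximum of \<psi> is at least t
    and -t, whatever the sign of t.\<close>
  from max[OF this(1)] max[OF this(2)] have "\<bar>t\<bar> \<le> t * mode e s"
    unfolding t fun_scale_def mode_leaves e(3) mode_on_edge[OF e(1,2)] by auto
  also have "\<dots> \<le> \<bar>t\<bar> * \<bar>mode e s\<bar>"
    by (metis abs_ge_self abs_mult)
  finally have "1 \<le> \<bar>mode e s\<bar>"
    using \<open>t \<noteq> 0\<close> by simp
  then have "4 \<le> e" "s = 0"
    using mode_abs_less_1[OF e(1,2)] by auto
  then show "x \<in> Vertex ` {4..<4 + 2 * (n * n)}"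
    using e by auto
qed

text \<open>Guarantees that the set of distances between hot spots is nonempty, so that it has a
  maximum.\<close>

lemma hot_spot_4: "Vertex 4 \<in> hot_spots G L"
proof -
  have "build 0 mode y \<le> 1" if y: "y \<in> points G L" for y
  proof -
    obtain e s where e: "e \<in> arcs G" "s \<in> {0..L e}" "y = on_edge G L e s"
      using y by (rule point_on_edge)
    then show ?thesis
      using mode_abs_le_1[OF e(1,2)] mode_on_edge[OF e(1,2)] by simp
  qed
  moreover have "Vertex 4 \<in> points G L"
    using leaf_arcs by (auto simp: points_def)
  moreover have "eigenfunction G L (freq\<^sup>2) (build 0 mode)"
    using mode_in_eigenspace[of 1] mode_nonzero by (simp add: eigenfunction_def fun_scale_def)
  ultimately show ?thesis
    by (auto simp: hot_spots_def mu_2 mode_leaves)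
qed

lemma hot_spots_close: "\<exists>d. has_max (distances G L (hot_spots G L)) d \<and> d \<le> 4 / n"
proof -
  let ?H = "hot_spots G L"
  have eq: "distances G L ?H = (\<lambda>(x, y). graph_dist G L x y) ` (?H \<times> ?H)"
    by (auto simp: distances_def)
  \<comment> \<open>There are only finitely many leaves, hence finitely many distances, and the
    maximum is attained.\<close>
  have "finite (distances G L ?H)" "distances G L ?H \<noteq> {}"
    using finite_subset[OF hot_spots_subset] hot_spot_4 unfolding eq by auto
  then have "has_max (distances G L ?H) (Max (distances G L ?H))"
    and "Max (distances G L ?H) \<in> distances G L ?H"
    by (auto simp: has_max_def)
  moreover have "r \<le> 4 / n" if r: "r \<in> distances G L ?H" for r
  proof -
    obtain x y where "x \<in> ?H" "y \<in> ?H" "r = graph_dist G L x y"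
      using r by (auto simp: distances_def)
    moreover from this obtain v w where "v \<in> {4..<4 + 2 * (n * n)}" "w \<in> {4..<4 + 2 * (n * n)}"
      "x = Vertex v" "y = Vertex w"
      using hot_spots_subset by (meson imageE subsetD)
    ultimately show ?thesis
      using graph_dist_short_edges[of v 0 w 0] edge_len_pos[of v] edge_len_pos[of w] by auto
  qed
  ultimately show ?thesis
    by blast
qed

end

theorem proposition4p11:
  fixes \<epsilon> :: real
  assumes "\<epsilon> > 0"
  shows "\<exists>(G :: (nat, nat) pre_digraph) (L :: nat \<Rightarrow> real).
    metric_tree G L \<and>
    has_max (distances G L (points G L)) 1 \<and>
    eigen_multiplicity G L (mu G L 2) = 1 \<and>
    (\<exists>d. has_max (distances G L (hot_spots G L)) d \<and> d < \<epsilon>)"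
proof -
  obtain m :: nat where m: "4 / \<epsilon> < m"
    using reals_Archimedean2 by blast
  \<comment> \<open>Exceeding 4 / \<epsilon> makes 4/n < \<epsilon>; the maximum with 4 meets the
    assumption of the locale.\<close>
  define n where "n = max 4 m"
  interpret dumbbell_tree n
    by unfold_locales (simp add: n_def)
  have "4 / \<epsilon> < n" "0 < real n"
    using m by (auto simp: n_def)
  then have "4 / n < \<epsilon>"
    using assms by (simp add: field_simps)
  then have "\<exists>d. has_max (distances G L (hot_spots G L)) d \<and> d < \<epsilon>"
    using hot_spots_close by force
  then show ?thesis
    using metric_tree_axioms diameter eigen_multiplicity_freq mu_2 by metis
qed

end
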